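(* Let $(G,\upsilon,\varepsilon)$ be a weighted multigraph on $n$ vertices and let $e=ab$ be an edge. Let $R$ be a rectangle, with height $h(R)$ and width $w(R)$, satisfying $\varepsilon(e)=\frac{w(R)}{h(R)}$, and consider any rectangular tiling of $R$. Let $(G',\upsilon',\varepsilon')$ be the weighted multigraph obtained from $(G,\upsilon,\varepsilon)$ by replacing the weighted edge $e$ with the edge-weighted graph associated with the tiling, identifying $a$ and $b$ with the vertices corresponding to the bottom and top sides of $R$, respectively, and letting the (positive) weights of the new vertices be arbitrary; let $k$ be the number of new vertices. Let $\lambda_1\le\dots\le\lambda_n$ and $\mu_1\le\dots\le\mu_{n+k}$ denote the weighted Laplacian eigenvalues (with multiplicity) of $(G,\upsilon,\varepsilon)$ and $(G',\upsilon',\varepsilon')$, respectively. Then $$\mu_i\le\lambda_i\le\mu_{i+k}$$ for all $1\le i\le n$.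
   Context: A graph is a finite multigraph with vertex set $V$ and edge set $E$ (loops and multiple edges allowed). A weighted multigraph $(G,\upsilon,\varepsilon)$ is a graph $G$ with vertex weights $\upsilon:V\to\mathbb R_{>0}$ and edge weights $\varepsilon:E\to\mathbb R_{>0}$. For $u,v\in V$, $\varepsilon(u,v)$ is the total edge weight between $u$ and $v$, with loops counted twice, and $d_{(G,\varepsilon)}(u)=\sum_{v\in V}\varepsilon(u,v)$. The combinatorial Laplacian is the $V\times V$ matrix $L_{(G,\varepsilon)}=D_{(G,\varepsilon)}-A_{(G,\varepsilon)}$, where $A_{(G,\varepsilon)}=(\varepsilon(u,v))_{u,v}$ and $D_{(G,\varepsilon)}$ is diagonal with entries $d_{(G,\varepsilon)}(v)$. The weighted Laplacian is $L_{(G,\upsilon,\varepsilon)}=W_\upsilon^{-1}L_{(G,\varepsilon)}$, where $W_\upsilon$ is the diagonal matrix with entries $\upsilon(v)$; it is self-adjoint for the inner product $\langle f,g\rangle=\sum_{v}f(v)g(v)\upsilon(v)$, so its eigenvalues are real. All rectangles lie in the plane, have positive dimensions and sides parallel to the axes; $h(r)$ and $w(r)$ denote the height and width of a rectangle $r$. A rectangular tiling of a rectangle $R$ is a subdivision of $R$ into finitely many interior-disjoint rectangles. The edge-weighted graph associated with a tiling has as vertices all horizontal lines in the plane which cover some horizontal side of a rectangle in the tiling, and as edges the rectangles of the subdivision; the edge $r$ connects the vertices (lines) containing the top and bottom sides of $r$, and has weight $\frac{w(r)}{h(r)}$. In $(G',\upsilon',\varepsilon')$, all vertices of $G$ and all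 edges of $G$ other than $e$ keep their original weights, and edges coming from the tiling have the weights just described; the new vertices are those corresponding to horizontal lines other than the ones containing the top and bottom sides of $R$. *)

theory Defs
  imports
    "HOL-Analysis.Analysis"
    "HOL-Library.Uprod"
    "Jordan_Normal_Form.Char_Poly"
begin

section \<open>Weighted multigraphs and their Laplacians\<close>

record ('v, 'e) multigraph =
  verts :: "'v set"
  edges :: "'e set"
  ends :: "'e \<Rightarrow> 'v uprod"

locale weighted_multigraph =
  fixes G :: "('v, 'e) multigraph" and \<upsilon> :: "'v \<Rightarrow> real" and \<epsilon> :: "'e \<Rightarrow> real"
  assumes finite_verts: "finite (verts G)"
    and finite_edges: "finite (edges G)"
    and ends_in_verts: "f \<in> edges G \<Longrightarrow> set_uprod (ends G f) \<subseteq> verts G"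
    and vertex_weight_pos: "u \<in> verts G \<Longrightarrow> \<upsilon> u > 0"
    and edge_weight_pos: "f \<in> edges G \<Longrightarrow> \<epsilon> f > 0"

definition total_weight :: "('v, 'e) multigraph \<Rightarrow> ('e \<Rightarrow> real) \<Rightarrow> 'v \<Rightarrow> 'v \<Rightarrow> real" where
  "total_weight G \<epsilon> u v =
     (\<Sum>f \<in> {f \<in> edges G. ends G f = Upair u v}. if u = v then 2 * \<epsilon> f else \<epsilon> f)"

definition weighted_degree :: "('v, 'e) multigraph \<Rightarrow> ('e \<Rightarrow> real) \<Rightarrow> 'v \<Rightarrow> real" where
  "weighted_degree G \<epsilon> u = (\<Sum>v \<in> verts G. total_weight G \<epsilon> u v)"

text \<open>Matrices with rows and columns indexed by vertices are first given by their entries.\<close>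

definition combinatorial_laplacian ::
    "('v, 'e) multigraph \<Rightarrow> ('e \<Rightarrow> real) \<Rightarrow> 'v \<Rightarrow> 'v \<Rightarrow> real" where
  "combinatorial_laplacian G \<epsilon> u v =
     (if u = v then weighted_degree G \<epsilon> u else 0) - total_weight G \<epsilon> u v"

definition weighted_laplacian ::
    "('v, 'e) multigraph \<Rightarrow> ('v \<Rightarrow> real) \<Rightarrow> ('e \<Rightarrow> real) \<Rightarrow> 'v \<Rightarrow> 'v \<Rightarrow> real" where
  "weighted_laplacian G \<upsilon> \<epsilon> u v = inverse (\<upsilon> u) * combinatorial_laplacian G \<epsilon> u v"

text \<open>
  To take a characteristic polynomial, the index set \<open>V\<close> is enumerated. Rows and columns use the
  same enumeration, so the polynomial does not depend on which one is chosen.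
\<close>

definition enumeration :: "'v set \<Rightarrow> 'v list" where
  "enumeration V = (SOME xs. distinct xs \<and> set xs = V)"

definition indexed_matrix :: "'v set \<Rightarrow> ('v \<Rightarrow> 'v \<Rightarrow> 'a) \<Rightarrow> 'a mat" where
  "indexed_matrix V A =
     mat (card V) (card V) (\<lambda>(i, j). A (enumeration V ! i) (enumeration V ! j))"

text \<open>
  The increasing list of eigenvalues, repeated according to their multiplicity as roots of the
  characteristic polynomial. The smallest one has position 0.
\<close>

definition laplacian_eigenvalues ::
    "('v, 'e) multigraph \<Rightarrow> ('v \<Rightarrow> real) \<Rightarrow> ('e \<Rightarrow> real) \<Rightarrow> real list" where
  "laplacian_eigenvalues G \<upsilon> \<epsilon> = sorted_list_of_multiset
     (proots (char_poly (indexed_matrix (verts G) (weighted_laplacian G \<upsilon> \<epsilon>))))"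


section \<open>The list of eigenvalues has one entry per vertex\<close>

lemma symmetrizable_eigenvalue_real:
  fixes S :: "nat \<Rightarrow> nat \<Rightarrow> real" and w :: "nat \<Rightarrow> real" and n :: nat
  defines "M \<equiv> mat n n (\<lambda>(i, j). inverse (w i) * S i j)"
  assumes symm: "\<And>i j. i < n \<Longrightarrow> j < n \<Longrightarrow> S i j = S j i"
    and pos: "\<And>i. i < n \<Longrightarrow> w i > 0"
    and ev: "eigenvalue (map_mat complex_of_real M) a"
  shows "a \<in> \<real>"
proof -
  from ev obtain v where v: "v \<in> carrier_vec n" "v \<noteq> 0\<^sub>v n"
    and eq: "map_mat complex_of_real M *\<^sub>v v = a \<cdot>\<^sub>v v"
    unfolding eigenvalue_def eigenvector_def M_def by auto
  define x where "x i = vec_index v i" for i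
  have row: "(\<Sum>j<n. of_real (S i j) * x j) = a * of_real (w i) * x i" if i: "i < n" for i
  proof -
    have "vec_index (map_mat complex_of_real M *\<^sub>v v) i = vec_index (a \<cdot>\<^sub>v v) i" by (simp only: eq)
    then have "(\<Sum>j<n. of_real (inverse (w i) * S i j) * x j) = a * x i"
      using i v unfolding M_def x_def by (simp add: scalar_prod_def atLeast0LessThan)
    then have "of_real (w i) * (\<Sum>j<n. of_real (inverse (w i) * S i j) * x j)
        = of_real (w i) * (a * x i)" by simp
    moreover have B: "of_real (w i) * (\<Sum>j<n. of_real (inverse (w i) * S i j) * x j)
        = (\<Sum>j<n. of_real (S i j) * x j)"
      unfolding sum_distrib_left using pos[OF i] by (intro sum.cong) auto
    ultimately have "(\<Sum>j<n. of_real (S i j) * x j) = of_real (w i) * (a * x i)"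
      by (simp only: B)
    then show ?thesis by (simp only: mult_ac)
  qed
  define q where "q = (\<Sum>i<n. \<Sum>j<n. of_real (S i j) * x j * cnj (x i))"
  define s where "s = (\<Sum>i<n. w i * (cmod (x i))\<^sup>2)"
  have q: "q = a * of_real s"
  proof -
    have "q = (\<Sum>i<n. (\<Sum>j<n. of_real (S i j) * x j) * cnj (x i))"
      unfolding q_def sum_distrib_right ..
    also have "\<dots> = (\<Sum>i<n. a * of_real (w i * (cmod (x i))\<^sup>2))"
    proof (intro sum.cong refl)
      fix i assume "i \<in> {..<n}"
      then have "(\<Sum>j<n. of_real (S i j) * x j) * cnj (x i)
          = a * of_real (w i) * (x i * cnj (x i))" by (simp add: row)
      also have "x i * cnj (x i) = of_real ((cmod (x i))\<^sup>2)" by (rule complex_norm_square[symmetric])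
      finally show "(\<Sum>j<n. of_real (S i j) * x j) * cnj (x i)
          = a * of_real (w i * (cmod (x i))\<^sup>2)" by simp
    qed
    finally show ?thesis unfolding s_def by (simp add: sum_distrib_left)
  qed
  have "cnj q = (\<Sum>i<n. \<Sum>j<n. of_real (S i j) * cnj (x j) * x i)"
    unfolding q_def by simp
  also have "\<dots> = (\<Sum>j<n. \<Sum>i<n. of_real (S i j) * cnj (x j) * x i)" by (rule sum.swap)
  also have "\<dots> = q" unfolding q_def by (intro sum.cong refl) (auto simp: symm mult_ac)
  finally have cq: "cnj q = q" .
  from v have "\<exists>i<n. x i \<noteq> 0" unfolding x_def
    by (metis carrier_vecD eq_vecI index_zero_vec(1) index_zero_vec(2))
  then obtain i where i: "i < n" "x i \<noteq> 0" by blast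
  have "0 < s" unfolding s_def
    by (rule sum_pos2[of _ i]) (use i pos in \<open>auto intro!: mult_nonneg_nonneg simp: less_imp_le\<close>)
  with q cq have "cnj a = a" by simp
  then show ?thesis by (simp add: Reals_cnj_iff)
qed

lemma size_proots_symmetrizable:
  fixes S :: "nat \<Rightarrow> nat \<Rightarrow> real" and w :: "nat \<Rightarrow> real" and n :: nat
  defines "M \<equiv> mat n n (\<lambda>(i, j). inverse (w i) * S i j)"
  assumes symm: "\<And>i j. i < n \<Longrightarrow> j < n \<Longrightarrow> S i j = S j i"
    and pos: "\<And>i. i < n \<Longrightarrow> w i > 0"
  shows "size (proots (char_poly M)) = n"
proof -
  let ?c = "complex_of_real"
  have M: "M \<in> carrier_mat n n" unfolding M_def by simp
  then have cM: "map_mat ?c M \<in> carrier_mat n n" by simp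
  from char_poly_factorized[OF cM] obtain as where
    as: "char_poly (map_mat ?c M) = (\<Prod>a\<leftarrow>as. [:- a, 1:])" "length as = n" by blast
  have "a \<in> \<real>" if "a \<in> set as" for a
  proof -
    have "poly (char_poly (map_mat ?c M)) a = 0"
      using that unfolding as by (auto simp: poly_prod_list prod_list_zero_iff)
    then have "eigenvalue (map_mat ?c M) a" using eigenvalue_root_char_poly[OF cM] by blast
    from symmetrizable_eigenvalue_real[OF symm pos this[unfolded M_def]] show ?thesis .
  qed
  then have re: "as = map ?c (map Re as)" by (induction as) auto
  interpret h: map_poly_inj_idom_hom ?c ..
  have "map_poly ?c (\<Prod>b\<leftarrow>bs. [:- b, 1:]) = (\<Prod>a\<leftarrow>map ?c bs. [:- a, 1:])" for bs
  proof (induction bs)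
    case (Cons b bs)
    have "map_poly ?c [:- b, 1:] = [:- ?c b, 1:]" by simp
    with Cons show ?case by (simp only: list.map prod_list.Cons h.hom_mult)
  qed simp
  from this[of "map Re as"]
  have "map_poly ?c (\<Prod>b\<leftarrow>map Re as. [:- b, 1:]) = map_poly ?c (char_poly M)"
    unfolding of_real_hom.char_poly_hom[OF M, symmetric] as(1) re[symmetric] .
  then have "(\<Prod>b\<leftarrow>map Re as. [:- b, 1:]) = char_poly M" by (rule h.injectivity)
  then have cp: "char_poly M = (\<Prod>b\<leftarrow>map Re as. [:- b, 1:])" by (rule sym)
  have "size (proots (\<Prod>b\<leftarrow>bs. [:- b, 1:])) = length bs" for bs :: "real list"
  proof (induction bs)
    case (Cons b bs)
    have "(\<Prod>b\<leftarrow>bs. [:- b, 1:]) \<noteq> (0 :: real poly)" by (auto simp: prod_list_zero_iff)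
    then have "proots ([:- b, 1:] * (\<Prod>b\<leftarrow>bs. [:- b, 1:]))
        = {#b#} + proots (\<Prod>b\<leftarrow>bs. [:- b, 1:])"
      by (subst proots_mult) simp_all
    with Cons show ?case by (simp only: list.map prod_list.Cons) simp
  qed simp
  from this[of "map Re as"] cp as(2) show ?thesis by simp
qed

lemma enumeration:
  assumes "finite V"
  shows "distinct (enumeration V)" and "set (enumeration V) = V"
    and "length (enumeration V) = card V"
proof -
  have *: "distinct (enumeration V) \<and> set (enumeration V) = V"
    unfolding enumeration_def using finite_distinct_list[OF assms] by (metis (mono_tags, lifting) someI_ex)
  then show "distinct (enumeration V)" "set (enumeration V) = V" by auto
  then show "length (enumeration V) = card V" using distinct_card by fastforce
qed

lemma total_weight_commute: "total_weight G \<epsilon> u v = total_weight G \<epsilon> v u"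
proof -
  have "Upair u v = Upair v u" by simp
  then show ?thesis unfolding total_weight_def by (auto intro: sum.cong)
qed

lemma (in weighted_multigraph) length_laplacian_eigenvalues:
  "length (laplacian_eigenvalues G \<upsilon> \<epsilon>) = card (verts G)"
proof -
  let ?x = "\<lambda>i. enumeration (verts G) ! i" and ?n = "card (verts G)"
  have x: "?x i \<in> verts G" if "i < ?n" for i
    using enumeration(2,3)[OF finite_verts] that nth_mem[of i "enumeration (verts G)"] by simp
  have "size (proots (char_poly (mat ?n ?n
      (\<lambda>(i, j). inverse (\<upsilon> (?x i)) * combinatorial_laplacian G \<epsilon> (?x i) (?x j))))) = ?n"
  proof (rule size_proots_symmetrizable)
    fix i j
    show "combinatorial_laplacian G \<epsilon> (?x i) (?x j) = combinatorial_laplacian G \<epsilon> (?x j) (?x i)"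
      unfolding combinatorial_laplacian_def
      using total_weight_commute[of G \<epsilon> "?x i" "?x j"] by auto
    show "\<upsilon> (?x i) > 0" if "i < ?n" using x[OF that] by (rule vertex_weight_pos)
  qed
  then show ?thesis
    unfolding laplacian_eigenvalues_def indexed_matrix_def weighted_laplacian_def
      size_mset[symmetric] mset_sorted_list_of_multiset .
qed


section \<open>Rectangles and tilings\<close>

type_synonym rect = "(real \<times> real) set"

definition is_rectangle :: "rect \<Rightarrow> bool" where
  "is_rectangle r \<longleftrightarrow> (\<exists>x\<^sub>1 x\<^sub>2 y\<^sub>1 y\<^sub>2. x\<^sub>1 < x\<^sub>2 \<and> y\<^sub>1 < y\<^sub>2 \<and> r = cbox (x\<^sub>1, y\<^sub>1) (x\<^sub>2, y\<^sub>2))"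

definition left_x :: "rect \<Rightarrow> real" where "left_x r = fst (interval_lowerbound r)"
definition right_x :: "rect \<Rightarrow> real" where "right_x r = fst (interval_upperbound r)"
definition bottom_y :: "rect \<Rightarrow> real" where "bottom_y r = snd (interval_lowerbound r)"
definition top_y :: "rect \<Rightarrow> real" where "top_y r = snd (interval_upperbound r)"

definition width :: "rect \<Rightarrow> real" where "width r = right_x r - left_x r"
definition height :: "rect \<Rightarrow> real" where "height r = top_y r - bottom_y r"

lemma rectangle_sides:
  assumes "x\<^sub>1 < x\<^sub>2" "y\<^sub>1 < y\<^sub>2"
  shows "left_x (cbox (x\<^sub>1, y\<^sub>1) (x\<^sub>2, y\<^sub>2)) = x\<^sub>1" "right_x (cbox (x\<^sub>1, y\<^sub>1) (x\<^sub>2, y\<^sub>2)) = x\<^sub>2"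
    "bottom_y (cbox (x\<^sub>1, y\<^sub>1) (x\<^sub>2, y\<^sub>2)) = y\<^sub>1" "top_y (cbox (x\<^sub>1, y\<^sub>1) (x\<^sub>2, y\<^sub>2)) = y\<^sub>2"
proof -
  have "cbox (x\<^sub>1, y\<^sub>1) (x\<^sub>2, y\<^sub>2) \<noteq> {}" using assms by (auto simp: cbox_Pair_eq)
  then have "interval_lowerbound (cbox (x\<^sub>1, y\<^sub>1) (x\<^sub>2, y\<^sub>2)) = (x\<^sub>1, y\<^sub>1)"
    "interval_upperbound (cbox (x\<^sub>1, y\<^sub>1) (x\<^sub>2, y\<^sub>2)) = (x\<^sub>2, y\<^sub>2)" by simp_all
  then show "left_x (cbox (x\<^sub>1, y\<^sub>1) (x\<^sub>2, y\<^sub>2)) = x\<^sub>1" "right_x (cbox (x\<^sub>1, y\<^sub>1) (x\<^sub>2, y\<^sub>2)) = x\<^sub>2"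
    "bottom_y (cbox (x\<^sub>1, y\<^sub>1) (x\<^sub>2, y\<^sub>2)) = y\<^sub>1" "top_y (cbox (x\<^sub>1, y\<^sub>1) (x\<^sub>2, y\<^sub>2)) = y\<^sub>2"
    unfolding left_x_def right_x_def bottom_y_def top_y_def by simp_all
qed

text \<open>
  \<open>division_of\<close> gives a finite set of interior-disjoint closed boxes with union \<open>R\<close>, but allows
  degenerate boxes.
\<close>

definition rectangular_tiling :: "rect set \<Rightarrow> rect \<Rightarrow> bool" where
  "rectangular_tiling T R \<longleftrightarrow> T division_of R \<and> (\<forall>r \<in> T. is_rectangle r)"

definition horizontal_line :: "real \<Rightarrow> (real \<times> real) set" where
  "horizontal_line y = {p. snd p = y}"

definition bottom_line :: "rect \<Rightarrow> (real \<times> real) set" where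
  "bottom_line r = horizontal_line (bottom_y r)"

definition top_line :: "rect \<Rightarrow> (real \<times> real) set" where
  "top_line r = horizontal_line (top_y r)"

definition tiling_graph :: "rect set \<Rightarrow> ((real \<times> real) set, rect) multigraph" where
  "tiling_graph T =
     \<lparr> verts = top_line ` T \<union> bottom_line ` T,
       edges = T,
       ends = (\<lambda>r. Upair (top_line r) (bottom_line r)) \<rparr>"

definition tiling_weight :: "rect \<Rightarrow> real" where
  "tiling_weight r = width r / height r"


section \<open>Replacing an edge by a graph\<close>

text \<open>
  In \<open>replace_edge G e a b H s t\<close> the edge \<open>e\<close>, with ends \<open>a\<close> and \<open>b\<close>, is deleted from \<open>G\<close>, and
  \<open>H\<close> is attached with \<open>s\<close> identified with \<open>a\<close> and \<open>t\<close> with \<open>b\<close>. Vertices and edges of \<open>G\<close> are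
  tagged \<open>Inl\<close>; those of \<open>H\<close> that are not identified are tagged \<open>Inr\<close>. If \<open>e\<close> is a loop, then
  \<open>s\<close> and \<open>t\<close> are identified with each other.
\<close>

definition replace_edge ::
    "('v, 'e) multigraph \<Rightarrow> 'e \<Rightarrow> 'v \<Rightarrow> 'v \<Rightarrow> ('w, 'f) multigraph \<Rightarrow> 'w \<Rightarrow> 'w
      \<Rightarrow> ('v + 'w, 'e + 'f) multigraph" where
  "replace_edge G e a b H s t =
     \<lparr> verts = Inl ` verts G \<union> Inr ` (verts H - {s, t}),
       edges = Inl ` (edges G - {e}) \<union> Inr ` edges H,
       ends = case_sum
         (\<lambda>f. map_uprod Inl (ends G f))
         (\<lambda>f. map_uprod (\<lambda>x. if x = s then Inl a else if x = t then Inl b else Inr x) (ends H f)) \<rparr>"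

lemma weighted_multigraph_replace_edge:
  assumes G: "weighted_multigraph G \<upsilon> \<epsilon>" and e: "e \<in> edges G" "ends G e = Upair a b"
    and H: "finite (verts H)" "finite (edges H)"
      "\<And>f. f \<in> edges H \<Longrightarrow> set_uprod (ends H f) \<subseteq> verts H" "\<And>f. f \<in> edges H \<Longrightarrow> \<eta> f > 0"
    and \<omega>: "\<And>x. x \<in> verts H - {s, t} \<Longrightarrow> \<omega> x > 0"
  shows "weighted_multigraph (replace_edge G e a b H s t) (case_sum \<upsilon> \<omega>) (case_sum \<epsilon> \<eta>)"
    and "card (verts (replace_edge G e a b H s t)) = card (verts G) + card (verts H - {s, t})"
proof -
  interpret weighted_multigraph G \<upsilon> \<epsilon> by (rule G)
  have ab: "a \<in> verts G" "b \<in> verts G" using ends_in_verts[OF e(1)] e(2) by auto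
  show "weighted_multigraph (replace_edge G e a b H s t) (case_sum \<upsilon> \<omega>) (case_sum \<epsilon> \<eta>)"
  proof
    show "finite (verts (replace_edge G e a b H s t))" "finite (edges (replace_edge G e a b H s t))"
      unfolding replace_edge_def by (simp_all add: finite_verts finite_edges H)
    show "set_uprod (ends (replace_edge G e a b H s t) f) \<subseteq> verts (replace_edge G e a b H s t)"
      if "f \<in> edges (replace_edge G e a b H s t)" for f
      using that ends_in_verts H(3) ab unfolding replace_edge_def
      by (fastforce simp: uprod.set_map)
    show "case_sum \<upsilon> \<omega> u > 0" if "u \<in> verts (replace_edge G e a b H s t)" for u
      using that vertex_weight_pos \<omega> unfolding replace_edge_def by fastforce
    show "case_sum \<epsilon> \<eta> f > 0" if "f \<in> edges (replace_edge G e a b H s t)" for f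
      using that edge_weight_pos H(4) unfolding replace_edge_def by auto
  qed
  show "card (verts (replace_edge G e a b H s t)) = card (verts G) + card (verts H - {s, t})"
    unfolding replace_edge_def
    by (simp, subst card_Un_disjoint) (auto simp: finite_verts H card_image)
qed

lemma tiling_graph_weighted:
  assumes "rectangular_tiling T R"
  shows "finite (verts (tiling_graph T))" "finite (edges (tiling_graph T))"
    and "\<And>r. r \<in> edges (tiling_graph T) \<Longrightarrow>
      set_uprod (ends (tiling_graph T) r) \<subseteq> verts (tiling_graph T)"
    and "\<And>r. r \<in> edges (tiling_graph T) \<Longrightarrow> tiling_weight r > 0"
proof -
  from assms have "finite T" and r: "\<And>r. r \<in> T \<Longrightarrow> is_rectangle r"
    unfolding rectangular_tiling_def by auto
  then show "finite (verts (tiling_graph T))" "finite (edges (tiling_graph T))"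
    unfolding tiling_graph_def by simp_all
  show "set_uprod (ends (tiling_graph T) r) \<subseteq> verts (tiling_graph T)"
    if "r \<in> edges (tiling_graph T)" for r
    using that unfolding tiling_graph_def by auto
  show "tiling_weight r > 0" if "r \<in> edges (tiling_graph T)" for r
  proof -
    from that have "is_rectangle r" using r unfolding tiling_graph_def by simp
    then obtain x\<^sub>1 x\<^sub>2 y\<^sub>1 y\<^sub>2 where
      *: "x\<^sub>1 < x\<^sub>2" "y\<^sub>1 < y\<^sub>2" "r = cbox (x\<^sub>1, y\<^sub>1) (x\<^sub>2, y\<^sub>2)"
      unfolding is_rectangle_def by blast
    then show ?thesis
      unfolding tiling_weight_def width_def height_def by (simp add: rectangle_sides)
  qed
qed

end

theory Submission
  imports Defs
begin

text \<open>
  The weighted Laplacian eigenvalues are governed by two quadratic quantities of a function on the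
  vertices: its energy \<open>\<Sum>\<epsilon>(uv) (f u - f v)\<^sup>2\<close> and its weighted squared norm \<open>\<Sum>\<upsilon>(u) (f u)\<^sup>2\<close>. The reason
  why the eigenvalues interlace is that the tiling, as an electrical network between the bottom and the
  top line of \<open>R\<close>, has effective conductance \<open>width R / height R\<close>, the weight of the edge that it
  replaces.

  For potentials \<open>\<psi>\<close> on the lines, the sum of \<open>width r * (gap of \<psi> across r)\<close> over the tiles equals
  \<open>width R * (gap of \<psi> across R)\<close> (\<open>tiling_flux\<close>): gaps telescope along vertical lines. Taking the height
  for \<open>\<psi>\<close> gives the area identity. By Cauchy-Schwarz the tiling never has less energy than the edge
  (\<open>tiling_energy_ge\<close>), and the height function attains equality (\<open>energy_relative_height\<close>).

  Consequently a function on the old vertices extends to the new graph with the same energy and no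
  smaller norm, and restricting a function from the new graph does not raise the energy and keeps the
  norm if the function vanishes on the \<open>k\<close> new vertices. A Courant-Fischer dimension count
  (\<open>eigenvalue_interlacing\<close>) turns the first comparison into \<open>\<mu>\<^sub>i \<le> \<lambda>\<^sub>i\<close> and the second, which costs \<open>k\<close>
  linear conditions, into \<open>\<lambda>\<^sub>i \<le> \<mu>\<^sub>i\<^sub>+\<^sub>k\<close>. The count needs an eigenbasis that is orthonormal for the weighted
  inner product and ordered like the roots of the characteristic polynomial; it comes from the spectral
  theorem for real symmetric matrices (\<open>real_symmetric_matrix_diagonalization\<close>).
\<close>

section \<open>The spectral theorem for real symmetric matrices\<close>

lemma monic_poly_eq_prod_proots:
  fixes p :: "'a :: idom poly"
  assumes "monic p" "proots p = mset es" "degree p = length es"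
  shows "p = (\<Prod>e\<leftarrow>es. [:- e, 1:])"
  using assms
proof (induction es arbitrary: p)
  case Nil
  then show ?case using monic_degree_0[of p] by simp
next
  case (Cons e es)
  have p0: "p \<noteq> 0" using Cons.prems(1) by auto
  have "e \<in># proots p" using Cons.prems by simp
  then have "poly p e = 0" using p0 by simp
  then obtain q where q: "p = [:- e, 1:] * q" by (auto simp: poly_eq_0_iff_dvd)
  have q0: "q \<noteq> 0" using p0 q by auto
  have "proots p = {#e#} + proots q" unfolding q using q0 by (subst proots_mult) auto
  moreover have "degree p = Suc (degree q)" unfolding q using q0 by (subst degree_mult_eq) auto
  moreover have "lead_coeff p = lead_coeff q" unfolding q lead_coeff_mult by simp
  ultimately have "q = (\<Prod>e\<leftarrow>es. [:- e, 1:])"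
    using Cons.prems by (intro Cons.IH) auto
  then show ?case using q by simp
qed

text \<open>
  The Householder reflection in the hyperplane orthogonal to \<open>v - e\<^sub>0\<close> exchanges the unit vectors
  \<open>v\<close> and \<open>e\<^sub>0\<close>. Being its own inverse and its own transpose, it is convenient for conjugation.
\<close>

lemma orthogonal_symmetric_matrix_first_column:
  fixes v :: "real vec"
  assumes v: "v \<in> carrier_vec n" "scalar_prod v v = 1"
  shows "\<exists>Q \<in> carrier_mat n n. transpose_mat Q = Q \<and> Q * Q = 1\<^sub>m n \<and> Q *\<^sub>v unit_vec n 0 = v"
proof (cases "v = unit_vec n 0")
  case True
  then show ?thesis by (intro bexI[of _ "1\<^sub>m n"]) auto
next
  case False
  have n: "0 < n" using v by (cases n) (auto simp: scalar_prod_def)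
  define u where "u i = vec_index v i - (if i = 0 then 1 else 0)" for i :: nat
  define s where "s = (\<Sum>i<n. (u i)\<^sup>2)"
  \<comment> \<open>Since \<open>v\<close> and \<open>e\<^sub>0\<close> are unit vectors, \<open>|v - e\<^sub>0|\<^sup>2 = 2 - 2 v\<^sub>0\<close>.\<close>
  have "s = (\<Sum>i<n. (vec_index v i)\<^sup>2 + (if i = 0 then 1 - 2 * vec_index v i else 0))"
    unfolding s_def u_def by (intro sum.cong) (auto simp: power2_eq_square algebra_simps)
  also have "\<dots> = (\<Sum>i<n. (vec_index v i)\<^sup>2) + (1 - 2 * vec_index v 0)"
    unfolding sum.distrib using n by simp
  also have "(\<Sum>i<n. (vec_index v i)\<^sup>2) = 1"
    using v by (simp add: scalar_prod_def power2_eq_square atLeast0LessThan)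
  finally have s: "s = - 2 * u 0" unfolding u_def by simp
  have "\<exists>k<n. u k \<noteq> 0"
  proof (rule ccontr)
    assume "\<not> (\<exists>k<n. u k \<noteq> 0)"
    then have "v = unit_vec n 0" using v(1) n unfolding u_def by (intro eq_vecI) auto
    with False show False ..
  qed
  then obtain k where k: "k < n" "u k \<noteq> 0" by blast
  have "0 < s" unfolding s_def by (rule sum_pos2[of _ k]) (use k in auto)
  then have s0: "s \<noteq> 0" by simp
  define Q where "Q = mat n n (\<lambda>(i, j). (if i = j then 1 else 0) - 2 / s * u i * u j)"
  have "Q * Q = 1\<^sub>m n"
  proof (rule eq_matI)
    fix i j assume "i < dim_row (1\<^sub>m n :: real mat)" "j < dim_col (1\<^sub>m n :: real mat)"
    then have ij: "i < n" "j < n" by auto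
    have "(Q * Q) $$ (i, j) = (\<Sum>k<n. ((if i = k then 1 else 0) - 2 / s * u i * u k)
        * ((if k = j then 1 else 0) - 2 / s * u k * u j))"
      using ij by (simp add: Q_def scalar_prod_def atLeast0LessThan)
    also have "\<dots> = (\<Sum>k<n. (if k = i then if i = j then 1 else 0 else 0)
        - (if k = j then 2 / s * u i * u j else 0)
        - (if k = i then 2 / s * u i * u j else 0) + 4 / s\<^sup>2 * u i * u j * (u k)\<^sup>2)"
      by (intro sum.cong) (auto simp: algebra_simps power2_eq_square)
    also have "\<dots> = (if i = j then 1 else 0) - 2 / s * u i * u j - 2 / s * u i * u j
        + 4 / s\<^sup>2 * u i * u j * s"
      unfolding sum.distrib sum_subtractf s_def sum_distrib_left[symmetric] using ij by simp
    also have "\<dots> = (if i = j then 1 else 0)" using s0 by (simp add: power2_eq_square)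
    finally show "(Q * Q) $$ (i, j) = 1\<^sub>m n $$ (i, j)" using ij by simp
  qed (auto simp: Q_def)
  moreover have "Q *\<^sub>v unit_vec n 0 = v"
  proof (rule eq_vecI)
    fix i assume "i < dim_vec v"
    then have i: "i < n" using v by simp
    then have "vec_index (Q *\<^sub>v unit_vec n 0) i = (if i = 0 then 1 else 0) - 2 / s * u i * u 0"
      using n by (simp add: Q_def scalar_prod_def atLeast0LessThan unit_vec_def if_distrib
          cong: if_cong)
    also have "\<dots> = (if i = 0 then 1 else 0) + u i" using s s0 by (simp add: field_simps)
    finally show "vec_index (Q *\<^sub>v unit_vec n 0) i = vec_index v i" unfolding u_def by simp
  qed (use v in \<open>auto simp: Q_def\<close>)
  moreover have "transpose_mat Q = Q" by (rule eq_matI) (auto simp: Q_def)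
  ultimately show ?thesis by (intro bexI[of _ Q]) (auto simp: Q_def)
qed

text \<open>
  The real spectral theorem, with the eigenvalues listed in a prescribed order. A reflection that
  sends \<open>e\<^sub>0\<close> to a unit eigenvector for the first eigenvalue conjugates the matrix to one whose first
  column, and by symmetry first row, vanishes off the diagonal; the remaining block is symmetric and
  has the remaining eigenvalues.
\<close>

theorem real_symmetric_matrix_diagonalization:
  fixes A :: "real mat"
  assumes "A \<in> carrier_mat n n" "transpose_mat A = A" "char_poly A = (\<Prod>e\<leftarrow>es. [:- e, 1:])"
  shows "\<exists>P \<in> carrier_mat n n. transpose_mat P * P = 1\<^sub>m n \<and> A * P = P * mat_diag n ((!) es)"
  using assms
proof (induction es arbitrary: n A)
  case Nil
  then have "n = 0" using degree_monic_char_poly[of A n] by simp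
  with Nil show ?case by (intro bexI[of _ "1\<^sub>m 0"]) (auto intro!: eq_matI simp: mat_diag_def)
next
  case (Cons e es)
  note A = Cons.prems(1)
  have "degree (char_poly A) = Suc (length es)"
    unfolding Cons.prems(3) using degree_linear_factors[of uminus "e # es"] by simp
  then obtain m where n: "n = Suc m" "m = length es" using degree_monic_char_poly[OF A] by auto
  have "poly (char_poly A) e = 0" unfolding Cons.prems(3) by simp
  then have "eigenvalue A e" using eigenvalue_root_char_poly[OF A] by blast
  then obtain x where x: "x \<in> carrier_vec n" "x \<noteq> 0\<^sub>v n" "A *\<^sub>v x = e \<cdot>\<^sub>v x"
    using A unfolding eigenvalue_def eigenvector_def by auto
  define s where "s = scalar_prod x x"
  have "\<exists>i<n. vec_index x i \<noteq> 0" using x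
    by (metis carrier_vecD eq_vecI index_zero_vec(1) index_zero_vec(2))
  then obtain i where "i < n" "vec_index x i \<noteq> 0" by blast
  then have s: "0 < s" unfolding s_def scalar_prod_def
    by (intro sum_pos2[of _ i]) (use x in \<open>auto simp: zero_less_mult_iff\<close>)
  define v where "v = (1 / sqrt s) \<cdot>\<^sub>v x"
  have v: "v \<in> carrier_vec n" using x(1) unfolding v_def by simp
  have "scalar_prod v v = (1 / sqrt s) * ((1 / sqrt s) * s)"
    unfolding v_def s_def using x(1)
    by (simp add: scalar_prod_smult_distrib[OF _ x(1)] smult_scalar_prod_distrib[OF x(1)])
  also have "\<dots> = 1" using s by simp
  finally have v1: "scalar_prod v v = 1" .
  have Av: "A *\<^sub>v v = e \<cdot>\<^sub>v v" unfolding v_def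
    by (simp add: mult_mat_vec[OF A x(1)] x(3) smult_smult_assoc mult.commute)
  from orthogonal_symmetric_matrix_first_column[OF v v1] obtain Q where
    Q: "Q \<in> carrier_mat n n" "transpose_mat Q = Q" "Q * Q = 1\<^sub>m n" "Q *\<^sub>v unit_vec n 0 = v" by blast
  define B where "B = Q * A * Q"
  have B: "B \<in> carrier_mat n n" unfolding B_def using Q A by auto
  have B_sym: "transpose_mat B = B" unfolding B_def
    using Q(1) A by (simp add: transpose_mult[of _ n n _ n] Q(2) Cons.prems(2) assoc_mult_mat[of _ n n _ n _ n])
  have "col B 0 = B *\<^sub>v unit_vec n 0" 
    by (rule eq_vecI) (use B n in auto)
  also have "\<dots> = Q *\<^sub>v (A *\<^sub>v (Q *\<^sub>v unit_vec n 0))"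
    unfolding B_def using Q(1) A by (simp add: assoc_mult_mat_vec[of _ n n _ n])
  also have "\<dots> = e \<cdot>\<^sub>v (Q *\<^sub>v v)" unfolding Q(4) Av using Q(1) v by (simp add: mult_mat_vec)
  also have "Q *\<^sub>v v = unit_vec n 0" unfolding Q(4)[symmetric]
    using Q(1) assoc_mult_mat_vec[of Q n n Q n "unit_vec n 0"] by (simp add: Q(3))
  finally have B_col: "col B 0 = e \<cdot>\<^sub>v unit_vec n 0" .
  have B0: "B $$ (i, 0) = (if i = 0 then e else 0)" if "i < n" for i
    using arg_cong[OF B_col, of "\<lambda>c. vec_index c i"] that B n by simp
  have B_swap: "B $$ (i, j) = B $$ (j, i)" if "i < n" "j < n" for i j
    using arg_cong[OF B_sym, of "\<lambda>M. M $$ (i, j)"] that B by simp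
  define C where "C = mat m m (\<lambda>(i, j). B $$ (Suc i, Suc j))"
  define E where "E = mat 1 1 (\<lambda>_. e)"
  have C: "C \<in> carrier_mat m m" and E: "E \<in> carrier_mat 1 1" unfolding C_def E_def by auto
  have B_block: "B = four_block_mat E (0\<^sub>m 1 m) (0\<^sub>m m 1) C"
  proof (rule eq_matI)
    fix i j
    assume "i < dim_row (four_block_mat E (0\<^sub>m 1 m) (0\<^sub>m m 1) C)"
      "j < dim_col (four_block_mat E (0\<^sub>m 1 m) (0\<^sub>m m 1) C)"
    then have ij: "i < n" "j < n" using C E n by auto
    then show "B $$ (i, j) = four_block_mat E (0\<^sub>m 1 m) (0\<^sub>m m 1) C $$ (i, j)"
      using C E n B0[OF ij(1)] B0[OF ij(2)] B_swap[OF ij]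
      by (cases i; cases j) (auto simp: C_def E_def)
  qed (use B C E n in auto)
  have "similar_mat B A"
    by (rule similar_matI[where P = Q and Q = Q and n = n]) (use Q A B in \<open>auto simp: B_def\<close>)
  then have "char_poly A = char_poly B" using char_poly_similar by metis
  also have "\<dots> = char_poly E * char_poly C"
    unfolding B_block by (rule char_poly_four_block_zeros_col[OF E _ C]) simp
  also have "char_poly E = [:- e, 1:]"
    using E by (simp add: char_poly_defs det_single) (simp add: E_def)
  finally have "char_poly C = (\<Prod>e\<leftarrow>es. [:- e, 1:])" unfolding Cons.prems(3)
    by (simp only: list.map prod_list.Cons mult_cancel_left) auto
  moreover have "transpose_mat C = C" by (rule eq_matI) (auto simp: C_def B_swap n)
  ultimately obtain P where P: "P \<in> carrier_mat m m" "transpose_mat P * P = 1\<^sub>m m"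
    "C * P = P * mat_diag m ((!) es)" using Cons.IH[OF C] by blast
  define R where "R = four_block_mat (1\<^sub>m 1) (0\<^sub>m 1 m) (0\<^sub>m m 1) P"
  define D where "D = mat_diag n ((!) (e # es))"
  have R: "R \<in> carrier_mat n n" 
    unfolding R_def n(1) using P(1) four_block_carrier_mat[of "1\<^sub>m 1" 1 1 P m m] by simp
  have D: "D \<in> carrier_mat n n" unfolding D_def by simp
  have D_block: "D = four_block_mat E (0\<^sub>m 1 m) (0\<^sub>m m 1) (mat_diag m ((!) es))"
    unfolding D_def n(1) E_def by (rule eq_matI) (auto simp: mat_diag_def nth_Cons')
  have block_mult: "four_block_mat X (0\<^sub>m 1 m) (0\<^sub>m m 1) Y * four_block_mat X' (0\<^sub>m 1 m) (0\<^sub>m m 1) Y'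
      = four_block_mat (X * X') (0\<^sub>m 1 m) (0\<^sub>m m 1) (Y * Y')"
    if "X \<in> carrier_mat 1 1" "X' \<in> carrier_mat 1 1" "Y \<in> carrier_mat m m" "Y' \<in> carrier_mat m m"
    for X X' Y Y' :: "real mat"
    using that by (subst mult_four_block_mat[of _ 1 1 _ m _ m _ _ 1 _ m]) simp_all
  have "transpose_mat R = four_block_mat (1\<^sub>m 1) (0\<^sub>m 1 m) (0\<^sub>m m 1) (transpose_mat P)"
    unfolding R_def using P(1) by (subst transpose_four_block_mat[of _ 1 1 _ m _ m]) simp_all
  then have "transpose_mat R * R
      = four_block_mat (1\<^sub>m 1 * 1\<^sub>m 1) (0\<^sub>m 1 m) (0\<^sub>m m 1) (transpose_mat P * P)"
    unfolding R_def by (simp only:) (rule block_mult, use P(1) in auto)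
  also have "\<dots> = 1\<^sub>m n" unfolding n(1) P(2) by (rule eq_matI) auto
  finally have RR: "transpose_mat R * R = 1\<^sub>m n" .
  have "B * R = four_block_mat (E * 1\<^sub>m 1) (0\<^sub>m 1 m) (0\<^sub>m m 1) (C * P)"
    unfolding B_block R_def by (rule block_mult) (use P(1) C E in auto)
  also have "\<dots> = four_block_mat (1\<^sub>m 1 * E) (0\<^sub>m 1 m) (0\<^sub>m m 1) (P * mat_diag m ((!) es))"
    unfolding P(3) right_mult_one_mat[OF E] left_mult_one_mat[OF E] ..
  also have "\<dots> = R * D"
    unfolding R_def D_block by (rule block_mult[symmetric]) (use P(1) E in auto)
  finally have BR: "B * R = R * D" .
  have "Q * B = (Q * Q) * (A * Q)" unfolding B_def
    using Q(1) A by (simp add: assoc_mult_mat[of _ n n _ n _ n])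
  then have QB: "Q * B = A * Q" unfolding Q(3) using Q(1) A by simp
  show ?case
  proof (intro bexI conjI)
    show "Q * R \<in> carrier_mat n n" using Q(1) R by simp
    have "transpose_mat (Q * R) * (Q * R) = transpose_mat R * ((Q * Q) * R)"
      using Q(1) R by (simp add: transpose_mult[of _ n n _ n] Q(2) assoc_mult_mat[of _ n n _ n _ n])
    then show "transpose_mat (Q * R) * (Q * R) = 1\<^sub>m n" unfolding Q(3) using R RR by simp
    have "A * (Q * R) = (Q * B) * R"
      unfolding QB using Q(1) R A by (simp add: assoc_mult_mat[of _ n n _ n _ n])
    also have "\<dots> = Q * (B * R)" using Q(1) B R by (rule assoc_mult_mat)
    also have "\<dots> = Q * R * D" unfolding BR using Q(1) R D
      by (simp add: assoc_mult_mat[of _ n n _ n _ n])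
    finally show "A * (Q * R) = Q * R * mat_diag n ((!) (e # es))" unfolding D_def .
  qed
qed


section \<open>Symmetric forms with respect to a weighted inner product\<close>

definition quadratic_form :: "'v set \<Rightarrow> ('v \<Rightarrow> 'v \<Rightarrow> real) \<Rightarrow> ('v \<Rightarrow> real) \<Rightarrow> real" where
  "quadratic_form V S f = (\<Sum>u\<in>V. \<Sum>v\<in>V. S u v * f u * f v)"

definition weighted_inner :: "'v set \<Rightarrow> ('v \<Rightarrow> real) \<Rightarrow> ('v \<Rightarrow> real) \<Rightarrow> ('v \<Rightarrow> real) \<Rightarrow> real" where
  "weighted_inner V w f g = (\<Sum>u\<in>V. w u * f u * g u)"

definition sorted_eigenvalues :: "'v set \<Rightarrow> ('v \<Rightarrow> 'v \<Rightarrow> real) \<Rightarrow> ('v \<Rightarrow> real) \<Rightarrow> real list" where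
  "sorted_eigenvalues V S w = sorted_list_of_multiset
     (proots (char_poly (indexed_matrix V (\<lambda>u v. inverse (w u) * S u v))))"

locale symmetric_form =
  fixes V :: "'v set" and S :: "'v \<Rightarrow> 'v \<Rightarrow> real" and w :: "'v \<Rightarrow> real"
  assumes finite_V: "finite V"
    and symmetric: "\<lbrakk>u \<in> V; v \<in> V\<rbrakk> \<Longrightarrow> S u v = S v u"
    and weight_pos: "u \<in> V \<Longrightarrow> 0 < w u"
begin

abbreviation "es \<equiv> sorted_eigenvalues V S w"

lemma length_sorted_eigenvalues: "length es = card V"
proof -
  let ?x = "\<lambda>i. enumeration V ! i"
  have x: "?x i \<in> V" if "i < card V" for i using enumeration[OF finite_V] that nth_mem by metis
  have "size (proots (char_poly (indexed_matrix V (\<lambda>u v. inverse (w u) * S u v)))) = card V"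
    unfolding indexed_matrix_def by (rule size_proots_symmetrizable) (use x symmetric weight_pos in auto)
  then show ?thesis
    unfolding sorted_eigenvalues_def by (metis mset_sorted_list_of_multiset size_mset)
qed

text \<open>
  With \<open>W = diag(w)\<close>, the matrix \<open>W\<^sup>-\<^sup>1 S\<close> is similar to the symmetric matrix with entries
  \<open>S u v / sqrt (w u * w v)\<close>. Dividing the \<open>u\<close>-th coordinates of an orthonormal eigenbasis of the latter by
  \<open>sqrt (w u)\<close> gives an eigenbasis of the former that is orthonormal for the weighted inner product.
  The second clause states that this basis is complete, as a resolution of the identity.
\<close>

lemma eigenbasis_exists:
  "\<exists>p :: nat \<Rightarrow> 'v \<Rightarrow> real.
     (\<forall>i < card V. \<forall>j < card V. weighted_inner V w (p i) (p j) = (if i = j then 1 else 0)) \<and>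
     (\<forall>u \<in> V. \<forall>v \<in> V. (\<Sum>i < card V. p i u * p i v) = (if u = v then 1 / w u else 0)) \<and>
     (\<forall>i < card V. \<forall>u \<in> V. (\<Sum>v\<in>V. S u v * p i v) = es ! i * w u * p i u)"
proof -
  define n where "n = card V"
  define x where "x = (!) (enumeration V)"
  have bij: "bij_betw x {..<n} V"
    unfolding x_def n_def using enumeration[OF finite_V] by (intro bij_betw_nth) auto
  have x: "x i \<in> V" if "i < n" for i using bij that by (auto simp: bij_betw_def)
  have x_eq: "x i = x j \<longleftrightarrow> i = j" if "i < n" "j < n" for i j
    using bij that by (auto simp: bij_betw_def inj_on_def)
  have sum_x: "(\<Sum>u\<in>V. f u) = (\<Sum>i<n. f (x i))" for f :: "'v \<Rightarrow> real"
    using sum.reindex_bij_betw[OF bij, of f] by simp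
  define r where "r i = sqrt (w (x i))" for i
  have r: "r i > 0" "r i * r i = w (x i)" if "i < n" for i
    unfolding r_def using weight_pos[OF x[OF that]] by auto
  have r0: "r i \<noteq> 0" if "i < n" for i using r(1)[OF that] by simp
  define M where "M = mat n n (\<lambda>(i, j). inverse (w (x i)) * S (x i) (x j))"
  define A where "A = mat n n (\<lambda>(i, j). S (x i) (x j) / (r i * r j))"
  have M: "M \<in> carrier_mat n n" and A: "A \<in> carrier_mat n n" unfolding M_def A_def by auto
  have es: "es = sorted_list_of_multiset (proots (char_poly M))"
    unfolding sorted_eigenvalues_def indexed_matrix_def M_def n_def x_def ..
  have len: "length es = n" unfolding n_def by (rule length_sorted_eigenvalues)
  have "similar_mat M A"
  proof (rule similar_matI)
    show "{M, A, mat_diag n (\<lambda>i. 1 / r i), mat_diag n r} \<subseteq> carrier_mat n n" using M A by auto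
    show "mat_diag n (\<lambda>i. 1 / r i) * mat_diag n r = 1\<^sub>m n"
      "mat_diag n r * mat_diag n (\<lambda>i. 1 / r i) = 1\<^sub>m n"
      unfolding mat_diag_diag by (auto simp: mat_diag_def r0 intro!: eq_matI)
    show "M = mat_diag n (\<lambda>i. 1 / r i) * A * mat_diag n r"
      unfolding mat_diag_mult_left[OF A] mat_diag_mult_right[OF mat_carrier]
      by (rule eq_matI) (simp_all add: M_def A_def r0 r(2)[symmetric] field_simps)
  qed
  then have char: "char_poly A = char_poly M" using char_poly_similar by metis
  have "char_poly A = (\<Prod>e\<leftarrow>es. [:- e, 1:])"
    unfolding char by (rule monic_poly_eq_prod_proots)
      (use degree_monic_char_poly[OF M] len in \<open>auto simp: es\<close>)
  moreover have "transpose_mat A = A"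
    by (rule eq_matI) (auto simp: A_def mult.commute symmetric x)
  ultimately obtain P where P: "P \<in> carrier_mat n n" "transpose_mat P * P = 1\<^sub>m n"
    "A * P = P * mat_diag n ((!) es)" using real_symmetric_matrix_diagonalization[OF A] by blast
  have PT: "P * transpose_mat P = 1\<^sub>m n"
    by (rule mat_mult_left_right_inverse[OF _ P(1) P(2)]) (use P in simp)
  have PTP_entry: "(\<Sum>k<n. P $$ (k, i) * P $$ (k, j)) = (if i = j then 1 else 0)"
    if "i < n" "j < n" for i j
    using arg_cong[OF P(2), of "\<lambda>M. M $$ (i, j)"] P(1) that
    by (simp add: scalar_prod_def atLeast0LessThan)
  have PPT_entry: "(\<Sum>k<n. P $$ (i, k) * P $$ (j, k)) = (if i = j then 1 else 0)"
    if "i < n" "j < n" for i j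
    using arg_cong[OF PT, of "\<lambda>M. M $$ (i, j)"] P(1) that
    by (simp add: scalar_prod_def atLeast0LessThan)
  have AP_entry: "(\<Sum>k<n. S (x i) (x k) / (r i * r k) * P $$ (k, j)) = es ! j * P $$ (i, j)"
    if "i < n" "j < n" for i j
    using arg_cong[OF P(3), of "\<lambda>M. M $$ (i, j)"] P(1) that
    by (simp add: scalar_prod_def atLeast0LessThan mat_diag_mult_right[OF P(1)] A_def mult.commute)
  define p where "p i u = (let k = inv_into {..<n} x u in P $$ (k, i) / r k)" for i u
  have p: "p i (x k) = P $$ (k, i) / r k" if "k < n" for i k
    unfolding p_def using bij that by (simp add: bij_betw_def)
  have "weighted_inner V w (p i) (p j) = (if i = j then 1 else 0)" if "i < n" "j < n" for i j
  proof -
    have "weighted_inner V w (p i) (p j) = (\<Sum>k<n. P $$ (k, i) * P $$ (k, j))"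
      unfolding weighted_inner_def sum_x
      by (intro sum.cong) (auto simp: p r0 r(2)[symmetric])
    then show ?thesis using PTP_entry that by simp
  qed
  moreover have "(\<Sum>i<n. p i u * p i v) = (if u = v then 1 / w u else 0)"
    if uv: "u \<in> V" "v \<in> V" for u v
  proof -
    obtain k l where kl: "k < n" "l < n" "u = x k" "v = x l"
      using uv bij by (metis bij_betw_def imageE lessThan_iff)
    have "(\<Sum>i<n. p i u * p i v) = (\<Sum>i<n. P $$ (k, i) * P $$ (l, i)) / (r k * r l)"
      unfolding kl sum_divide_distrib using kl by (intro sum.cong) (auto simp: p)
    then show ?thesis using kl by (simp add: PPT_entry x_eq r(2))
  qed
  moreover have "(\<Sum>v\<in>V. S u v * p i v) = es ! i * w u * p i u" if u: "u \<in> V" and i: "i < n" for u i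
  proof -
    obtain k where k: "k < n" "u = x k" using u bij by (metis bij_betw_def imageE lessThan_iff)
    have "(\<Sum>v\<in>V. S u v * p i v) = r k * (\<Sum>l<n. S (x k) (x l) / (r k * r l) * P $$ (l, i))"
      unfolding sum_x sum_distrib_left k(2) using r0[OF k(1)] by (intro sum.cong) (auto simp: p)
    also have "\<dots> = es ! i * (r k * r k) * p i u"
      unfolding AP_entry[OF k(1) i] using k r0 by (simp add: p)
    finally show ?thesis using k by (simp add: r(2))
  qed
  ultimately show ?thesis unfolding n_def by blast
qed

lemma sorted_eigenvalues_mono: "i \<le> j \<Longrightarrow> j < card V \<Longrightarrow> es ! i \<le> es ! j"
  using sorted_nth_mono[of es i j] length_sorted_eigenvalues
  by (simp add: sorted_eigenvalues_def)

text \<open>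
  In coordinates \<open>c\<^sub>i\<close> with respect to the eigenbasis, the form is \<open>\<Sum>\<^sub>i es\<^sub>i c\<^sub>i\<^sup>2\<close> and the squared norm is
  \<open>\<Sum>\<^sub>i c\<^sub>i\<^sup>2\<close>. Hence a vector without components before (after) position \<open>m\<close> has Rayleigh quotient
  at least (at most) the \<open>m\<close>-th eigenvalue.
\<close>

lemma rayleigh_eigenbasis_exists:
  "\<exists>p :: nat \<Rightarrow> 'v \<Rightarrow> real.
     (\<forall>i < card V. \<forall>j < card V. weighted_inner V w (p i) (p j) = (if i = j then 1 else 0)) \<and>
     (\<forall>f. \<forall>m < card V. (\<forall>i < m. weighted_inner V w f (p i) = 0) \<longrightarrow>
        es ! m * weighted_inner V w f f \<le> quadratic_form V S f) \<and>
     (\<forall>f. \<forall>m < card V. (\<forall>i \<in> {m<..<card V}. weighted_inner V w f (p i) = 0) \<longrightarrow>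
        quadratic_form V S f \<le> es ! m * weighted_inner V w f f)"
proof -
  obtain p where orth: "\<And>i j. i < card V \<Longrightarrow> j < card V \<Longrightarrow>
        weighted_inner V w (p i) (p j) = (if i = j then 1 else 0)"
    and complete: "\<And>u v. u \<in> V \<Longrightarrow> v \<in> V \<Longrightarrow>
        (\<Sum>i < card V. p i u * p i v) = (if u = v then 1 / w u else 0)"
    and eigen: "\<And>i u. i < card V \<Longrightarrow> u \<in> V \<Longrightarrow> (\<Sum>v\<in>V. S u v * p i v) = es ! i * w u * p i u"
    using eigenbasis_exists by blast
  define c where "c f i = weighted_inner V w f (p i)" for f i
  have expand: "f u = (\<Sum>i<card V. c f i * p i u)" if u: "u \<in> V" for f u
  proof -
    have "(\<Sum>i<card V. c f i * p i u) = (\<Sum>v\<in>V. w v * f v * (\<Sum>i<card V. p i v * p i u))"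
      unfolding c_def weighted_inner_def sum_distrib_left sum_distrib_right
      by (subst sum.swap) (simp add: mult_ac)
    also have "\<dots> = (\<Sum>v\<in>V. if v = u then f u else 0)"
      using u weight_pos[OF u] by (intro sum.cong) (auto simp: complete)
    finally show ?thesis using u finite_V by simp
  qed
  have norm: "weighted_inner V w f f = (\<Sum>i<card V. (c f i)\<^sup>2)" for f
  proof -
    have "weighted_inner V w f f = (\<Sum>u\<in>V. w u * f u * (\<Sum>i<card V. c f i * p i u))"
      unfolding weighted_inner_def using expand by (intro sum.cong) auto
    also have "\<dots> = (\<Sum>i<card V. c f i * weighted_inner V w f (p i))"
      unfolding weighted_inner_def sum_distrib_left by (subst sum.swap) (simp add: mult_ac)
    finally show ?thesis by (simp add: c_def power2_eq_square)
  qed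
  have form: "quadratic_form V S f = (\<Sum>i<card V. es ! i * (c f i)\<^sup>2)" for f
  proof -
    have "quadratic_form V S f = (\<Sum>u\<in>V. \<Sum>v\<in>V. S u v * f u * (\<Sum>i<card V. c f i * p i v))"
      unfolding quadratic_form_def using expand by (intro sum.cong) auto
    also have "\<dots> = (\<Sum>u\<in>V. f u * (\<Sum>i<card V. c f i * (\<Sum>v\<in>V. S u v * p i v)))"
      unfolding sum_distrib_left
      by (intro sum.cong refl, subst sum.swap) (simp add: mult_ac)
    also have "\<dots> = (\<Sum>u\<in>V. f u * (\<Sum>i<card V. c f i * (es ! i * w u * p i u)))"
      by (intro sum.cong) (auto simp: eigen)
    also have "\<dots> = (\<Sum>i<card V. es ! i * c f i * weighted_inner V w f (p i))"
      unfolding weighted_inner_def sum_distrib_left by (subst sum.swap) (simp add: mult_ac)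
    finally show ?thesis by (simp add: c_def power2_eq_square mult_ac)
  qed
  have "es ! m * weighted_inner V w f f \<le> quadratic_form V S f"
    if "m < card V" "\<forall>i < m. weighted_inner V w f (p i) = 0" for f m
    unfolding norm form sum_distrib_left
  proof (rule sum_mono)
    fix i assume "i \<in> {..<card V}"
    then show "es ! m * (c f i)\<^sup>2 \<le> es ! i * (c f i)\<^sup>2"
      using that sorted_eigenvalues_mono[of m i]
      by (cases "i < m") (auto simp: c_def intro: mult_right_mono)
  qed
  moreover have "quadratic_form V S f \<le> es ! m * weighted_inner V w f f"
    if "m < card V" "\<forall>i \<in> {m<..<card V}. weighted_inner V w f (p i) = 0" for f m
    unfolding norm form sum_distrib_left
  proof (rule sum_mono)
    fix i assume "i \<in> {..<card V}"
    then show "es ! i * (c f i)\<^sup>2 \<le> es ! m * (c f i)\<^sup>2"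
      using that sorted_eigenvalues_mono[of i m]
      by (cases "m < i") (auto simp: c_def intro: mult_right_mono)
  qed
  ultimately show ?thesis using orth by blast
qed

end


section \<open>Interlacing of eigenvalues by a dimension count\<close>

text \<open>
  Gaussian elimination: an equation with a nonzero coefficient expresses one unknown by the
  others, and substituting it removes one equation and one unknown.
\<close>

lemma homogeneous_system_nontrivial_solution:
  fixes A :: "'i \<Rightarrow> 'j \<Rightarrow> 'a :: field"
  assumes "finite I" "finite J" "card I < card J"
  shows "\<exists>c. (\<exists>j\<in>J. c j \<noteq> 0) \<and> (\<forall>i\<in>I. (\<Sum>j\<in>J. A i j * c j) = 0)"
  using assms
proof (induction I arbitrary: A J rule: finite_induct)
  case empty
  then have "J \<noteq> {}" by auto
  then show ?case by (intro exI[of _ "\<lambda>_. 1"]) auto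
next
  case (insert r I)
  show ?case
  proof (cases "\<forall>j\<in>J. A r j = 0")
    case True
    have "card I < card J" using insert by simp
    from insert.IH[OF insert.prems(1) this, of A] True show ?thesis by auto
  next
    case False
    then obtain p where p: "p \<in> J" "A r p \<noteq> 0" by blast
    have "card I < card (J - {p})" using insert p by simp
    from insert.IH[OF _ this, of "\<lambda>i j. A i j - A i p * A r j / A r p"] insert.prems
    obtain c where c: "\<exists>j\<in>J - {p}. c j \<noteq> 0"
      and eq: "\<And>i. i \<in> I \<Longrightarrow> (\<Sum>j\<in>J - {p}. (A i j - A i p * A r j / A r p) * c j) = 0"
      by auto
    define s where "s = (\<Sum>j\<in>J - {p}. A r j * c j)"
    define d where "d = c(p := - s / A r p)"
    have split: "(\<Sum>j\<in>J. A i j * d j) = A i p * (- s / A r p) + (\<Sum>j\<in>J - {p}. A i j * c j)" for i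
      unfolding d_def using insert.prems(1) p(1)
      by (subst sum.remove[of _ p]) (auto intro!: sum.cong)
    have "(\<Sum>j\<in>J. A i j * d j) = 0" if "i \<in> insert r I" for i
    proof (cases "i = r")
      case True
      then show ?thesis unfolding split using p(2) by (simp add: s_def)
    next
      case False
      then have "(\<Sum>j\<in>J - {p}. (A i j - A i p * A r j / A r p) * c j) = 0" using eq that by simp
      moreover have "(\<Sum>j\<in>J - {p}. (A i j - A i p * A r j / A r p) * c j)
          = (\<Sum>j\<in>J - {p}. A i j * c j) - A i p / A r p * s"
        unfolding s_def sum_distrib_left sum_subtractf[symmetric]
        by (intro sum.cong) (auto simp: algebra_simps)
      ultimately show ?thesis unfolding split by simp
    qed
    moreover have "\<exists>j\<in>J. d j \<noteq> 0" using c unfolding d_def by auto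
    ultimately show ?thesis by blast
  qed
qed

text \<open>
  The Courant-Fischer dimension count. A combination of the first \<open>i + card Z + 1\<close> eigenvectors of
  \<open>(S, w)\<close> can satisfy \<open>i + card Z\<close> linear conditions without being zero: that it vanishes on \<open>Z\<close>, and
  that its image under \<open>K\<close> is orthogonal to the first \<open>i\<close> eigenvectors of \<open>(S', w')\<close>. Comparing the two
  Rayleigh quotients at this vector gives the inequality. The norm may grow under \<open>K\<close> because the
  eigenvalue on the right is nonnegative.
\<close>

theorem eigenvalue_interlacing:
  fixes K :: "('v \<Rightarrow> real) \<Rightarrow> 'u \<Rightarrow> real"
  assumes form: "symmetric_form V S w" and form': "symmetric_form V' S' w'"
    and Z: "Z \<subseteq> V"
    and nonneg: "\<And>f. 0 \<le> quadratic_form V S f"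
    and linear: "\<And>c (p :: nat \<Rightarrow> 'v \<Rightarrow> real) m u.
      K (\<lambda>v. \<Sum>j<m. c j * p j v) u = (\<Sum>j<m. c j * K (p j) u)"
    and energy: "\<And>f. \<forall>z\<in>Z. f z = 0 \<Longrightarrow> quadratic_form V' S' (K f) \<le> quadratic_form V S f"
    and norm: "\<And>f. \<forall>z\<in>Z. f z = 0 \<Longrightarrow> weighted_inner V w f f \<le> weighted_inner V' w' (K f) (K f)"
    and i: "i < card V'" "i + card Z < card V"
  shows "sorted_eigenvalues V' S' w' ! i \<le> sorted_eigenvalues V S w ! (i + card Z)"
proof -
  interpret V: symmetric_form V S w by (rule form)
  interpret V': symmetric_form V' S' w' by (rule form')
  let ?m = "i + card Z"
  obtain p where orth: "\<And>i j. i < card V \<Longrightarrow> j < card V \<Longrightarrow>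
      weighted_inner V w (p i) (p j) = (if i = j then 1 else 0)"
    and upper: "\<And>f. \<forall>j \<in> {?m<..<card V}. weighted_inner V w f (p j) = 0 \<Longrightarrow>
        quadratic_form V S f \<le> V.es ! ?m * weighted_inner V w f f"
    using V.rayleigh_eigenbasis_exists i by blast
  obtain p' where lower: "\<And>f. \<forall>j < i. weighted_inner V' w' f (p' j) = 0 \<Longrightarrow>
        V'.es ! i * weighted_inner V' w' f f \<le> quadratic_form V' S' f"
    using V'.rayleigh_eigenbasis_exists i by blast
  have finZ: "finite Z" using Z V.finite_V finite_subset by blast
  \<comment> \<open>The conditions in the unknown coefficients: orthogonality is tagged \<open>Inl\<close>, vanishing \<open>Inr\<close>.\<close>
  define a where
    "a l j = case_sum (\<lambda>l. weighted_inner V' w' (K (p j)) (p' l)) (\<lambda>z. p j z) l" for l j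
  have "card ({..<i} <+> Z) < card {..<Suc ?m}" using finZ by (simp add: card_Plus)
  from homogeneous_system_nontrivial_solution[OF _ _ this, of a] finZ
  obtain c j0 where j0: "j0 < Suc ?m" "c j0 \<noteq> 0"
    and c: "\<And>l. l \<in> {..<i} <+> Z \<Longrightarrow> (\<Sum>j<Suc ?m. a l j * c j) = 0"
    by (auto simp del: sum.lessThan_Suc)
  define f where "f v = (\<Sum>j<Suc ?m. c j * p j v)" for v
  have Kf: "K f u = (\<Sum>j<Suc ?m. c j * K (p j) u)" for u
    using linear[of c p "Suc ?m" u] unfolding f_def .
  have fZ: "\<forall>z\<in>Z. f z = 0" using c[OF InrI] by (simp add: a_def f_def mult.commute del: sum.lessThan_Suc)
  have "weighted_inner V' w' (K f) (p' l) = (\<Sum>j<Suc ?m. weighted_inner V' w' (K (p j)) (p' l) * c j)" for l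
    unfolding weighted_inner_def Kf sum_distrib_left sum_distrib_right
    by (subst sum.swap) (simp add: mult_ac del: sum.lessThan_Suc)
  then have "\<forall>l<i. weighted_inner V' w' (K f) (p' l) = 0" using c[OF InlI] by (simp add: a_def del: sum.lessThan_Suc)
  note low = lower[OF this]
  have inner_f: "weighted_inner V w f (p l) = (\<Sum>j<Suc ?m. c j * weighted_inner V w (p j) (p l))" for l
    unfolding weighted_inner_def f_def sum_distrib_left sum_distrib_right
    by (subst sum.swap) (simp add: mult_ac del: sum.lessThan_Suc)
  have coeff: "weighted_inner V w f (p l) = (if l < Suc ?m then c l else 0)" if "l < card V" for l
  proof -
    have "weighted_inner V w f (p l) = (\<Sum>j<Suc ?m. if j = l then c l else 0)"
      unfolding inner_f using that i by (intro sum.cong) (auto simp: orth)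
    then show ?thesis by (simp del: sum.lessThan_Suc)
  qed
  have up: "quadratic_form V S f \<le> V.es ! ?m * weighted_inner V w f f"
    by (rule upper) (auto simp: coeff)
  have f_nonneg: "0 \<le> weighted_inner V w f f"
    unfolding weighted_inner_def using V.weight_pos
    by (intro sum_nonneg) (simp add: mult.assoc less_imp_le)
  \<comment> \<open>The combination is not zero because \<open>p\<close> is orthonormal and \<open>c j0\<close> is not zero.\<close>
  have "weighted_inner V w f f \<noteq> 0"
  proof
    assume *: "weighted_inner V w f f = 0"
    have "\<forall>u\<in>V. w u * f u * f u = 0"
      using * unfolding weighted_inner_def
      by (subst (asm) sum_nonneg_eq_0_iff[OF V.finite_V]) (use V.weight_pos in \<open>auto simp: mult.assoc less_imp_le\<close>)
    then have "\<forall>u\<in>V. f u = 0" using V.weight_pos by fastforce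
    then have "weighted_inner V w f (p j0) = 0" unfolding weighted_inner_def by simp
    then show False using coeff[of j0] j0 i by simp
  qed
  with f_nonneg have f_pos: "0 < weighted_inner V w f f" by simp
  have "0 \<le> V.es ! ?m * weighted_inner V w f f" using nonneg[of f] up by linarith
  then have es_nonneg: "0 \<le> V.es ! ?m" using f_pos by (simp add: zero_le_mult_iff)
  have "V'.es ! i * weighted_inner V' w' (K f) (K f) \<le> quadratic_form V' S' (K f)" by (rule low)
  also have "\<dots> \<le> quadratic_form V S f" by (rule energy[OF fZ])
  also have "\<dots> \<le> V.es ! ?m * weighted_inner V w f f" by (rule up)
  also have "\<dots> \<le> V.es ! ?m * weighted_inner V' w' (K f) (K f)"
    using es_nonneg norm[OF fZ] by (rule mult_left_mono[rotated])
  finally show ?thesis using f_pos norm[OF fZ] by simp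
qed


section \<open>Energies of weighted multigraphs\<close>

text \<open>
  This is \<open>|f u - f v|\<close> for an edge with ends \<open>u\<close> and \<open>v\<close>. It refers only to the set of ends, so it
  needs no choice of orientation and commutes with relabelling of the vertices.
\<close>

definition edge_gap :: "('v \<Rightarrow> real) \<Rightarrow> 'v uprod \<Rightarrow> real" where
  "edge_gap f P = Max (f ` set_uprod P) - Min (f ` set_uprod P)"

lemma edge_gap_Upair: "(edge_gap f (Upair u v))\<^sup>2 = (f u - f v)\<^sup>2"
  by (cases "f u \<le> f v") (auto simp: edge_gap_def max_def min_def power2_commute)

lemma edge_gap_map: "edge_gap f (map_uprod h P) = edge_gap (f \<circ> h) P"
  by (simp add: edge_gap_def uprod.set_map image_comp)

text \<open>The Dirichlet energy; for conductances \<open>\<epsilon>\<close> and potentials \<open>f\<close> it is the power dissipated.\<close>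

definition energy :: "('v, 'e) multigraph \<Rightarrow> ('e \<Rightarrow> real) \<Rightarrow> ('v \<Rightarrow> real) \<Rightarrow> real" where
  "energy G \<epsilon> f = (\<Sum>e\<in>edges G. \<epsilon> e * (edge_gap f (ends G e))\<^sup>2)"

context weighted_multigraph
begin

lemma energy_nonneg: "0 \<le> energy G \<epsilon> f"
  unfolding energy_def by (intro sum_nonneg mult_nonneg_nonneg) (use edge_weight_pos in \<open>auto simp: less_imp_le\<close>)

text \<open>
  Summation by parts. A loop adds its weight twice to both the degree and the diagonal adjacency entry,
  so it contributes nothing to either side.
\<close>

lemma quadratic_form_combinatorial_laplacian:
  "quadratic_form (verts G) (combinatorial_laplacian G \<epsilon>) f = energy G \<epsilon> f"
proof -
  let ?V = "verts G" and ?t = "total_weight G \<epsilon>"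
  have "(\<Sum>u\<in>?V. \<Sum>v\<in>?V. combinatorial_laplacian G \<epsilon> u v * f u * f v)
      = (\<Sum>u\<in>?V. \<Sum>v\<in>?V. ?t u v * (f u)\<^sup>2) - (\<Sum>u\<in>?V. \<Sum>v\<in>?V. ?t u v * f u * f v)"
    unfolding sum_subtractf[symmetric]
  proof (rule sum.cong[OF refl])
    fix u assume u: "u \<in> ?V"
    have "(\<Sum>v\<in>?V. combinatorial_laplacian G \<epsilon> u v * f u * f v)
        = (\<Sum>v\<in>?V. (if v = u then weighted_degree G \<epsilon> u * (f u)\<^sup>2 else 0) - ?t u v * f u * f v)"
      by (intro sum.cong) (auto simp: combinatorial_laplacian_def algebra_simps power2_eq_square)
    also have "\<dots> = (\<Sum>v\<in>?V. ?t u v * (f u)\<^sup>2 - ?t u v * f u * f v)"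
      unfolding sum_subtractf using u finite_verts
      by (simp add: weighted_degree_def sum_distrib_right)
    finally show "(\<Sum>v\<in>?V. combinatorial_laplacian G \<epsilon> u v * f u * f v)
        = (\<Sum>v\<in>?V. ?t u v * (f u)\<^sup>2 - ?t u v * f u * f v)" .
  qed
  moreover have "(\<Sum>u\<in>?V. \<Sum>v\<in>?V. ?t u v * (f u)\<^sup>2) = (\<Sum>u\<in>?V. \<Sum>v\<in>?V. ?t u v * (f v)\<^sup>2)"
    by (subst sum.swap) (simp add: total_weight_commute[of G \<epsilon>])
  ultimately have "2 * (\<Sum>u\<in>?V. \<Sum>v\<in>?V. combinatorial_laplacian G \<epsilon> u v * f u * f v)
      = (\<Sum>u\<in>?V. \<Sum>v\<in>?V. ?t u v * (f u)\<^sup>2) + (\<Sum>u\<in>?V. \<Sum>v\<in>?V. ?t u v * (f v)\<^sup>2)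
        - 2 * (\<Sum>u\<in>?V. \<Sum>v\<in>?V. ?t u v * f u * f v)" by simp
  also have "\<dots> = (\<Sum>u\<in>?V. \<Sum>v\<in>?V. ?t u v * (f u - f v)\<^sup>2)"
    unfolding sum_distrib_left sum.distrib[symmetric] sum_subtractf[symmetric]
    by (intro sum.cong) (auto simp: power2_eq_square algebra_simps)
  also have "\<dots> = (\<Sum>u\<in>?V. \<Sum>v\<in>?V. \<Sum>e\<in>edges G. if ends G e = Upair u v then \<epsilon> e * (f u - f v)\<^sup>2 else 0)"
  proof (intro sum.cong refl)
    fix u v
    have "?t u v * (f u - f v)\<^sup>2 = (\<Sum>e \<in> {e \<in> edges G. ends G e = Upair u v}. \<epsilon> e * (f u - f v)\<^sup>2)"
      unfolding total_weight_def sum_distrib_right by (intro sum.cong) auto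
    then show "?t u v * (f u - f v)\<^sup>2
        = (\<Sum>e\<in>edges G. if ends G e = Upair u v then \<epsilon> e * (f u - f v)\<^sup>2 else 0)"
      using finite_edges by (simp add: sum.inter_filter)
  qed
  also have "\<dots> = (\<Sum>e\<in>edges G. \<Sum>u\<in>?V. \<Sum>v\<in>?V. if ends G e = Upair u v then \<epsilon> e * (f u - f v)\<^sup>2 else 0)"
    by (rule trans[OF sum.cong[OF refl sum.swap] sum.swap])
  also have "\<dots> = (\<Sum>e\<in>edges G. 2 * (\<epsilon> e * (edge_gap f (ends G e))\<^sup>2))"
  proof (intro sum.cong refl)
    fix e assume e: "e \<in> edges G"
    obtain x y where xy: "ends G e = Upair x y" by (cases "ends G e") auto
    with ends_in_verts[OF e] have V: "x \<in> ?V" "y \<in> ?V" by auto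
    define g where "g = \<epsilon> e * (f x - f y)\<^sup>2"
    have "(\<Sum>u\<in>?V. \<Sum>v\<in>?V. if ends G e = Upair u v then \<epsilon> e * (f u - f v)\<^sup>2 else 0)
        = (\<Sum>u\<in>?V. \<Sum>v\<in>?V. (if v = y then if u = x then g else 0 else 0)
            + (if v = x then if u = y then g else 0 else 0))"
      unfolding xy g_def by (intro sum.cong) (auto simp: power2_commute)
    also have "\<dots> = 2 * g" unfolding sum.distrib using V finite_verts by simp
    finally show "(\<Sum>u\<in>?V. \<Sum>v\<in>?V. if ends G e = Upair u v then \<epsilon> e * (f u - f v)\<^sup>2 else 0)
        = 2 * (\<epsilon> e * (edge_gap f (ends G e))\<^sup>2)" unfolding g_def xy edge_gap_Upair .
  qed
  finally show ?thesis
    unfolding quadratic_form_def energy_def sum_distrib_left[symmetric] by simp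
qed

lemma symmetric_form_combinatorial_laplacian:
  "symmetric_form (verts G) (combinatorial_laplacian G \<epsilon>) \<upsilon>"
proof
  show "combinatorial_laplacian G \<epsilon> u v = combinatorial_laplacian G \<epsilon> v u" for u v
    using total_weight_commute[of G \<epsilon> u v] by (auto simp: combinatorial_laplacian_def)
qed (use finite_verts vertex_weight_pos in auto)

end

lemma laplacian_eigenvalues_eq_sorted_eigenvalues:
  "laplacian_eigenvalues G \<upsilon> \<epsilon> = sorted_eigenvalues (verts G) (combinatorial_laplacian G \<epsilon>) \<upsilon>"
  unfolding laplacian_eigenvalues_def sorted_eigenvalues_def weighted_laplacian_def[abs_def] ..

lemma energy_affine: "energy G \<epsilon> (\<lambda>x. \<alpha> + \<beta> * h x) = \<beta>\<^sup>2 * energy G \<epsilon> h"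
proof -
  have gap: "(edge_gap (\<lambda>x. \<alpha> + \<beta> * h x) P)\<^sup>2 = \<beta>\<^sup>2 * (edge_gap h P)\<^sup>2" for P
    by (cases P) (simp add: edge_gap_Upair power_mult_distrib[symmetric] algebra_simps)
  show ?thesis unfolding energy_def gap by (simp add: sum_distrib_left mult_ac)
qed

text \<open>The deleted edge's term is added on the left to keep both sides free of subtraction.\<close>

lemma energy_replace_edge:
  assumes e: "e \<in> edges G" "ends G e = Upair a b" and fin: "finite (edges G)" "finite (edges H)"
  shows "energy (replace_edge G e a b H s t) (case_sum \<epsilon> \<eta>) f + \<epsilon> e * (f (Inl a) - f (Inl b))\<^sup>2
    = energy G \<epsilon> (f \<circ> Inl)
      + energy H \<eta> (\<lambda>x. f (if x = s then Inl a else if x = t then Inl b else Inr x))"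
proof -
  have "energy (replace_edge G e a b H s t) (case_sum \<epsilon> \<eta>) f
      = (\<Sum>g\<in>edges G - {e}. \<epsilon> g * (edge_gap (f \<circ> Inl) (ends G g))\<^sup>2)
        + energy H \<eta> (\<lambda>x. f (if x = s then Inl a else if x = t then Inl b else Inr x))"
    unfolding energy_def replace_edge_def using fin
    by (simp, subst sum.union_disjoint) (auto simp: sum.reindex edge_gap_map comp_def)
  moreover have "energy G \<epsilon> (f \<circ> Inl) = \<epsilon> e * (f (Inl a) - f (Inl b))\<^sup>2
      + (\<Sum>g\<in>edges G - {e}. \<epsilon> g * (edge_gap (f \<circ> Inl) (ends G g))\<^sup>2)"
    unfolding energy_def using e fin by (simp add: sum.remove[of _ e] edge_gap_Upair)
  ultimately show ?thesis by simp
qed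


section \<open>Replacing an edge by a network of the same effective conductance\<close>

text \<open>
  The two conditions on energies say that, between \<open>s\<close> and \<open>t\<close>, the network \<open>H\<close> has effective
  conductance \<open>\<epsilon> e\<close>, with \<open>h\<close> as its equilibrium potential. For the first inequality, a function on the
  old vertices is extended by the equilibrium potential of \<open>H\<close>, which keeps the energy and does not decrease
  the norm. For the second, a function that vanishes on the new vertices is restricted to the old
  ones, which keeps the norm and does not increase the energy.
\<close>

theorem replace_edge_interlacing:
  fixes G :: "('v, 'e) multigraph" and H :: "('w, 'f) multigraph"
  assumes G: "weighted_multigraph G \<upsilon> \<epsilon>" and e: "e \<in> edges G" "ends G e = Upair a b"
    and H: "finite (verts H)" "finite (edges H)"
      "\<And>f. f \<in> edges H \<Longrightarrow> set_uprod (ends H f) \<subseteq> verts H" "\<And>f. f \<in> edges H \<Longrightarrow> \<eta> f > 0"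
    and \<omega>: "\<And>x. x \<in> verts H - {s, t} \<Longrightarrow> \<omega> x > 0"
    and st: "s \<noteq> t"
    and lower: "\<And>\<psi>. \<epsilon> e * (\<psi> s - \<psi> t)\<^sup>2 \<le> energy H \<eta> \<psi>"
    and h: "h s = 0" "h t = 1" "energy H \<eta> h = \<epsilon> e"
    and i: "i < card (verts G)"
  shows "laplacian_eigenvalues (replace_edge G e a b H s t) (case_sum \<upsilon> \<omega>) (case_sum \<epsilon> \<eta>) ! i
      \<le> laplacian_eigenvalues G \<upsilon> \<epsilon> ! i" (is ?below)
    and "laplacian_eigenvalues G \<upsilon> \<epsilon> ! i
      \<le> laplacian_eigenvalues (replace_edge G e a b H s t) (case_sum \<upsilon> \<omega>) (case_sum \<epsilon> \<eta>)
          ! (i + card (verts H - {s, t}))" (is ?above)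
proof -
  let ?G' = "replace_edge G e a b H s t" and ?\<upsilon>' = "case_sum \<upsilon> \<omega>" and ?\<epsilon>' = "case_sum \<epsilon> \<eta>"
  let ?new = "verts H - {s, t}"
  interpret G: weighted_multigraph G \<upsilon> \<epsilon> by (rule G)
  interpret G': weighted_multigraph ?G' ?\<upsilon>' ?\<epsilon>'
    by (rule weighted_multigraph_replace_edge(1)[OF G e H \<omega>])
  have card: "card (verts ?G') = card (verts G) + card ?new"
    by (rule weighted_multigraph_replace_edge(2)[OF G e H \<omega>])
  have verts: "verts ?G' = Inl ` verts G \<union> Inr ` ?new" unfolding replace_edge_def by simp
  have inner: "weighted_inner (verts ?G') ?\<upsilon>' f f
      = weighted_inner (verts G) \<upsilon> (f \<circ> Inl) (f \<circ> Inl) + weighted_inner ?new \<omega> (f \<circ> Inr) (f \<circ> Inr)"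
    for f unfolding weighted_inner_def verts using G.finite_verts H(1)
    by (subst sum.union_disjoint) (auto simp: sum.reindex)
  \<comment> \<open>The vertex of the new graph that a vertex of \<open>H\<close> becomes.\<close>
  define \<iota> where "\<iota> x = (if x = s then Inl a else if x = t then Inl b else Inr x)" for x :: 'w
  have \<iota>: "\<iota> s = Inl a" "\<iota> t = Inl b" using st unfolding \<iota>_def by auto
  have balance: "energy ?G' ?\<epsilon>' f + \<epsilon> e * (f (Inl a) - f (Inl b))\<^sup>2
      = energy G \<epsilon> (f \<circ> Inl) + energy H \<eta> (\<lambda>x. f (\<iota> x))" for f
    using energy_replace_edge[OF e G.finite_edges H(2), of s t \<epsilon> \<eta> f] unfolding \<iota>_def .
  note forms = G.quadratic_form_combinatorial_laplacian G'.quadratic_form_combinatorial_laplacian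
  note eigenvalues = laplacian_eigenvalues_eq_sorted_eigenvalues
  note G_form = G.symmetric_form_combinatorial_laplacian
  note G'_form = G'.symmetric_form_combinatorial_laplacian
  show ?below
  proof -
    \<comment> \<open>The potential on \<open>H\<close> with boundary values \<open>f a\<close> and \<open>f b\<close>.\<close>
    define K where "K f = case_sum f (\<lambda>x. f a + (f b - f a) * h x)" for f :: "'v \<Rightarrow> real"
    have K_Inl: "K f \<circ> Inl = f" for f unfolding K_def by auto
    have K_\<iota>: "K f (\<iota> x) = f a + (f b - f a) * h x" for f x
      using h unfolding K_def \<iota>_def by auto
    have K_energy: "energy ?G' ?\<epsilon>' (K f) = energy G \<epsilon> f" for f
    proof -
      have "energy H \<eta> (\<lambda>x. K f (\<iota> x)) = \<epsilon> e * (f a - f b)\<^sup>2"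
        unfolding K_\<iota> energy_affine h(3) by (simp add: power2_commute)
      moreover have "K f (Inl a) = f a" "K f (Inl b) = f b" unfolding K_def by auto
      ultimately show ?thesis using balance[of "K f"] unfolding K_Inl by simp
    qed
    have "sorted_eigenvalues (verts ?G') (combinatorial_laplacian ?G' ?\<epsilon>') ?\<upsilon>' ! i
        \<le> sorted_eigenvalues (verts G) (combinatorial_laplacian G \<epsilon>) \<upsilon> ! (i + card ({} :: 'v set))"
    proof (rule eigenvalue_interlacing[where K = K, OF G_form G'_form])
      show "0 \<le> quadratic_form (verts G) (combinatorial_laplacian G \<epsilon>) f" for f
        unfolding forms by (rule G.energy_nonneg)
      show "K (\<lambda>v. \<Sum>j<m. c j * p j v) u = (\<Sum>j<m. c j * K (p j) u)" for c p and m :: nat and u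
        by (cases u) (simp_all add: K_def algebra_simps sum.distrib sum_subtractf sum_distrib_left)
      show "quadratic_form (verts ?G') (combinatorial_laplacian ?G' ?\<epsilon>') (K f)
          \<le> quadratic_form (verts G) (combinatorial_laplacian G \<epsilon>) f" for f
        unfolding forms K_energy ..
      show "weighted_inner (verts G) \<upsilon> f f \<le> weighted_inner (verts ?G') ?\<upsilon>' (K f) (K f)" for f
      proof -
        have "0 \<le> weighted_inner ?new \<omega> g g" for g
          unfolding weighted_inner_def using \<omega>
          by (intro sum_nonneg) (simp add: mult.assoc less_imp_le)
        then show ?thesis unfolding inner K_Inl by simp
      qed
    qed (use i card in auto)
    then show ?thesis unfolding eigenvalues by simp
  qed
  show ?above
  proof -
    define K where "K f = f \<circ> Inl" for f :: "'v + 'w \<Rightarrow> real"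
    have "sorted_eigenvalues (verts G) (combinatorial_laplacian G \<epsilon>) \<upsilon> ! i
        \<le> sorted_eigenvalues (verts ?G') (combinatorial_laplacian ?G' ?\<epsilon>') ?\<upsilon>'
            ! (i + card (Inr ` ?new :: ('v + 'w) set))"
    proof (rule eigenvalue_interlacing[where K = K, OF G'_form G_form])
      show "0 \<le> quadratic_form (verts ?G') (combinatorial_laplacian ?G' ?\<epsilon>') f" for f
        unfolding forms by (rule G'.energy_nonneg)
      show "K (\<lambda>v. \<Sum>j<m. c j * p j v) u = (\<Sum>j<m. c j * K (p j) u)" for c p and m :: nat and u
        by (simp add: K_def)
      show "quadratic_form (verts G) (combinatorial_laplacian G \<epsilon>) (K f)
          \<le> quadratic_form (verts ?G') (combinatorial_laplacian ?G' ?\<epsilon>') f" for f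
        using balance[of f] lower[of "\<lambda>x. f (\<iota> x)"] unfolding forms K_def \<iota> by simp
      show "weighted_inner (verts ?G') ?\<upsilon>' f f \<le> weighted_inner (verts G) \<upsilon> (K f) (K f)"
        if "\<forall>z\<in>Inr ` ?new. f z = 0" for f
      proof -
        have "weighted_inner ?new \<omega> (f \<circ> Inr) (f \<circ> Inr) = 0"
          using that unfolding weighted_inner_def by (intro sum.neutral) auto
        then show ?thesis unfolding inner K_def by simp
      qed
    qed (use i card verts in \<open>auto simp: card_image\<close>)
    then show ?thesis unfolding eigenvalues by (simp add: card_image)
  qed
qed


section \<open>The effective conductance of a tiling\<close>

text \<open>
  For a vertical line in general position, the increments of \<open>\<phi>\<close> over the tiles that it crosses
  telescope; integrating over all such lines gives the identity. The proof uses instead that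
  \<open>width r * (\<phi> (top_y r) - \<phi> (bottom_y r))\<close> is additive when a rectangle is cut in two, vertically or
  horizontally, whatever the function \<open>\<phi>\<close> is, and that such set functions are additive over divisions.
\<close>

lemma tiling_flux:
  fixes \<phi> :: "real \<Rightarrow> real"
  assumes "rectangular_tiling T R" "is_rectangle R"
  shows "(\<Sum>r\<in>T. width r * (\<phi> (top_y r) - \<phi> (bottom_y r))) = width R * (\<phi> (top_y R) - \<phi> (bottom_y R))"
proof -
  \<comment> \<open>On the empty set the side coordinates have arbitrary values, so it needs its own case.\<close>
  define g where "g r = (if r = {} then 0 else width r * (\<phi> (top_y r) - \<phi> (bottom_y r)))" for r
  have g: "g (cbox (x1, y1) (x2, y2)) =
      (if x1 \<le> x2 \<and> y1 \<le> y2 then (x2 - x1) * (\<phi> y2 - \<phi> y1) else 0)" for x1 x2 y1 y2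
  proof (cases "x1 \<le> x2 \<and> y1 \<le> y2")
    case True
    then have "cbox (x1, y1) (x2, y2) \<noteq> {}" by (auto simp: cbox_Pair_eq)
    then show ?thesis using True
      by (simp add: g_def width_def right_x_def left_x_def top_y_def bottom_y_def)
  next
    case False
    then have "cbox (x1, y1) (x2, y2) = {}" by (auto simp: cbox_Pair_eq)
    then show ?thesis using False by (auto simp: g_def)
  qed
  interpret operative plus 0 g
    rewrites "comm_monoid_set.F (+) 0 = sum"
  proof -
    show "operative (+) 0 g"
    proof
      fix p q :: "real \<times> real"
      obtain x1 y1 x2 y2 where pq: "p = (x1, y1)" "q = (x2, y2)" by (metis surj_pair)
      show "g (cbox p q) = 0" if "box p q = {}"
      proof -
        have "x2 \<le> x1 \<or> y2 \<le> y1" using that unfolding pq box_eq_empty by (auto simp: Basis_prod_def)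
        then show ?thesis unfolding pq g by auto
      qed
      fix k :: "real \<times> real" and c
      assume "k \<in> Basis"
      then consider "k = (1, 0)" | "k = (0, 1)" by (auto simp: Basis_prod_def)
      then show "g (cbox p q) = g (cbox p q \<inter> {x. x \<bullet> k \<le> c}) + g (cbox p q \<inter> {x. x \<bullet> k \<ge> c})"
      proof cases
        case 1
        have cut: "cbox p q \<inter> {x. x \<bullet> k \<le> c} = cbox (x1, y1) (min x2 c, y2)"
          "cbox p q \<inter> {x. x \<bullet> k \<ge> c} = cbox (max x1 c, y1) (x2, y2)"
          unfolding 1 pq by (auto simp: cbox_Pair_eq)
        show ?thesis unfolding cut unfolding pq g by (auto simp: min_def max_def algebra_simps)
      next
        case 2
        have cut: "cbox p q \<inter> {x. x \<bullet> k \<le> c} = cbox (x1, y1) (x2, min y2 c)"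
          "cbox p q \<inter> {x. x \<bullet> k \<ge> c} = cbox (x1, max y1 c) (x2, y2)"
          unfolding 2 pq by (auto simp: cbox_Pair_eq)
        show ?thesis unfolding cut unfolding pq g by (auto simp: min_def max_def algebra_simps)
      qed
    qed
    show "comm_monoid_set.F (+) 0 = sum" by (simp add: sum_def)
  qed
  obtain p q where R: "R = cbox p q" using assms(2) unfolding is_rectangle_def by blast
  have "sum g T = g R" unfolding R
    by (rule division) (use assms(1) in \<open>simp add: rectangular_tiling_def R\<close>)
  moreover have "r \<noteq> {}" if "is_rectangle r" for r
    using that unfolding is_rectangle_def by (auto simp: cbox_Pair_eq)
  ultimately show ?thesis using assms unfolding g_def rectangular_tiling_def by simp
qed

lemma rectangle_height_width_pos:
  assumes "is_rectangle r"
  shows "0 < height r" "0 < width r"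
  using assms unfolding is_rectangle_def height_def width_def by (auto simp: rectangle_sides)

lemma tiling_area:
  assumes "rectangular_tiling T R" "is_rectangle R"
  shows "(\<Sum>r\<in>T. width r * height r) = width R * height R"
  using tiling_flux[OF assms, of "\<lambda>y. y"] unfolding height_def .

lemma energy_tiling_graph:
  "energy (tiling_graph T) tiling_weight \<psi>
    = (\<Sum>r\<in>T. tiling_weight r * (\<psi> (top_line r) - \<psi> (bottom_line r))\<^sup>2)"
  unfolding energy_def tiling_graph_def by (simp add: edge_gap_Upair)

text \<open>
  This is Cauchy-Schwarz for the flux and area identities. It is proved by summing over the tiles the
  inequality \<open>(d - c * height)\<^sup>2 \<ge> 0\<close>, where \<open>c\<close> is the mean slope of the potential across \<open>R\<close>.
\<close>

lemma tiling_energy_ge: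
  assumes T: "rectangular_tiling T R" and R: "is_rectangle R"
  shows "width R / height R * (\<psi> (bottom_line R) - \<psi> (top_line R))\<^sup>2
    \<le> energy (tiling_graph T) tiling_weight \<psi>"
proof -
  define d where "d r = \<psi> (top_line r) - \<psi> (bottom_line r)" for r
  define c where "c = d R / height R"
  note posR = rectangle_height_width_pos[OF R]
  have flux: "(\<Sum>r\<in>T. width r * d r) = width R * d R"
    using tiling_flux[OF T R, of "\<lambda>y. \<psi> (horizontal_line y)"]
    unfolding d_def top_line_def bottom_line_def .
  have "width R / height R * (\<psi> (bottom_line R) - \<psi> (top_line R))\<^sup>2 = width R / height R * (d R)\<^sup>2"
    unfolding d_def by (simp add: power2_commute)
  also have "\<dots> = 2 * c * (width R * d R) - c\<^sup>2 * (width R * height R)"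
    using posR by (simp add: c_def field_simps power2_eq_square)
  also have "\<dots> = (\<Sum>r\<in>T. 2 * c * (width r * d r) - c\<^sup>2 * (width r * height r))"
    unfolding sum_subtractf sum_distrib_left[symmetric] tiling_area[OF T R] flux ..
  also have "\<dots> \<le> (\<Sum>r\<in>T. tiling_weight r * (d r)\<^sup>2)"
  proof (rule sum_mono)
    fix r assume "r \<in> T"
    then have pos: "0 < height r" "0 < width r"
      using T rectangle_height_width_pos unfolding rectangular_tiling_def by auto
    have "0 \<le> width r / height r * (d r - c * height r)\<^sup>2" using pos by simp
    also have "\<dots> = tiling_weight r * (d r)\<^sup>2 - (2 * c * (width r * d r) - c\<^sup>2 * (width r * height r))"
      using pos unfolding tiling_weight_def by (simp add: field_simps power2_eq_square)
    finally show "2 * c * (width r * d r) - c\<^sup>2 * (width r * height r) \<le> tiling_weight r * (d r)\<^sup>2"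
      by simp
  qed
  finally show ?thesis unfolding d_def energy_tiling_graph .
qed

definition relative_height :: "rect \<Rightarrow> (real \<times> real) set \<Rightarrow> real" where
  "relative_height R l = (the_inv horizontal_line l - bottom_y R) / height R"

lemma inj_horizontal_line: "inj horizontal_line"
  by (rule injI) (auto simp: horizontal_line_def set_eq_iff)

lemma relative_height_horizontal_line:
  "relative_height R (horizontal_line y) = (y - bottom_y R) / height R"
  unfolding relative_height_def the_inv_f_f[OF inj_horizontal_line] ..

text \<open>
  The gap of the height function across a tile is the height of the tile, so each tile contributes its
  area and the total is the area of \<open>R\<close>.
\<close>

lemma energy_relative_height:
  assumes T: "rectangular_tiling T R" and R: "is_rectangle R"
  shows "energy (tiling_graph T) tiling_weight (relative_height R) = width R / height R"
proof -
  have "energy (tiling_graph T) tiling_weight (relative_height R)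
      = (\<Sum>r\<in>T. width r * height r) / (height R)\<^sup>2"
    unfolding energy_tiling_graph sum_divide_distrib
  proof (rule sum.cong[OF refl])
    fix r assume "r \<in> T"
    then have "0 < height r"
      using T rectangle_height_width_pos unfolding rectangular_tiling_def by auto
    moreover have "relative_height R (top_line r) - relative_height R (bottom_line r)
        = height r / height R"
      unfolding top_line_def bottom_line_def relative_height_horizontal_line height_def
      by (simp add: diff_divide_distrib)
    ultimately show "tiling_weight r
        * (relative_height R (top_line r) - relative_height R (bottom_line r))\<^sup>2
      = width r * height r / (height R)\<^sup>2"
      by (simp add: tiling_weight_def power2_eq_square)
  qed
  then show ?thesis
    using rectangle_height_width_pos[OF R] by (simp add: tiling_area[OF T R] power2_eq_square)
qed


section \<open>Interlacing for tilings\<close>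

theorem theorem6p3:
  fixes G :: "('v, 'e) multigraph"
    and \<upsilon> :: "'v \<Rightarrow> real" and \<epsilon> :: "'e \<Rightarrow> real"
    and e :: 'e and a b :: 'v
    and R :: rect and T :: "rect set"
    and \<omega> :: "(real \<times> real) set \<Rightarrow> real"
    and n k :: nat
  defines "new \<equiv> verts (tiling_graph T) - {bottom_line R, top_line R}"
  defines "G' \<equiv> replace_edge G e a b (tiling_graph T) (bottom_line R) (top_line R)"
    and "\<upsilon>' \<equiv> case_sum \<upsilon> \<omega>"
    and "\<epsilon>' \<equiv> case_sum \<epsilon> tiling_weight"
  assumes "weighted_multigraph G \<upsilon> \<epsilon>"
    and "e \<in> edges G" and "ends G e = Upair a b"
    and "is_rectangle R" and "\<epsilon> e = width R / height R"
    and "rectangular_tiling T R"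
    and "\<And>l. l \<in> new \<Longrightarrow> \<omega> l > 0"
    and "n = card (verts G)" and "k = card new"
  shows "\<forall>i \<in> {1..n}.
      laplacian_eigenvalues G' \<upsilon>' \<epsilon>' ! (i - 1) \<le> laplacian_eigenvalues G \<upsilon> \<epsilon> ! (i - 1) \<and>
      laplacian_eigenvalues G \<upsilon> \<epsilon> ! (i - 1) \<le> laplacian_eigenvalues G' \<upsilon>' \<epsilon>' ! (i + k - 1)"
proof -
  from assms(8) have pos: "0 < height R" by (rule rectangle_height_width_pos)
  then have "bottom_y R \<noteq> top_y R" unfolding height_def by simp
  then have lines: "bottom_line R \<noteq> top_line R"
    using inj_horizontal_line unfolding bottom_line_def top_line_def by (auto dest: injD)
  have \<omega>: "\<omega> l > 0" if "l \<in> verts (tiling_graph T) - {bottom_line R, top_line R}" for l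
    using assms(11) that unfolding new_def by blast
  have lower: "\<epsilon> e * (\<psi> (bottom_line R) - \<psi> (top_line R))\<^sup>2
      \<le> energy (tiling_graph T) tiling_weight \<psi>" for \<psi>
    unfolding assms(9) by (rule tiling_energy_ge[OF assms(10,8)])
  have h: "relative_height R (bottom_line R) = 0" "relative_height R (top_line R) = 1"
    "energy (tiling_graph T) tiling_weight (relative_height R) = \<epsilon> e"
    using pos energy_relative_height[OF assms(10,8)] unfolding assms(9)
    by (simp_all add: bottom_line_def top_line_def relative_height_horizontal_line height_def)
  show ?thesis
  proof
    fix i assume i: "i \<in> {1..n}"
    then have "i - 1 < card (verts G)" using assms(12) by auto
    note interlacing = replace_edge_interlacing
      [OF assms(5,6,7) tiling_graph_weighted[OF assms(10)] \<omega> lines lower h this]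
    have "i + k - 1 = i - 1 + k" using i by auto
    then show "laplacian_eigenvalues G' \<upsilon>' \<epsilon>' ! (i - 1) \<le> laplacian_eigenvalues G \<upsilon> \<epsilon> ! (i - 1) \<and>
      laplacian_eigenvalues G \<upsilon> \<epsilon> ! (i - 1) \<le> laplacian_eigenvalues G' \<upsilon>' \<epsilon>' ! (i + k - 1)"
      using interlacing
      unfolding G'_def \<upsilon>'_def \<epsilon>'_def assms(13) new_def by simp
  qed
qed

end
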